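(* Let $\Omega=[a,b]$ with partition $a=x_0<x_1<\dots<x_m=b$, $\Omega_j=(x_{j-1},x_j)$, $m\ge 1$, and let $p,q,w$ be complex-valued functions on $\Omega$, extended periodically to $\mathbb{R}$ with period $\ell=b-a$. Assume: (1) for every $j\in\{1,\dots,m\}$: $p,w\in W^{2,\infty}(\Omega_j)$, $\inf_{x\in\overline{\Omega_j}}|p(x)|>0$ and $\inf_{x\in\overline{\Omega_j}}|w(x)|>0$; (2) $w/p=r^2$ on $\Omega$ for some $r:\Omega\to(0,\infty)$ (also extended $\ell$-periodically); (3) $q\in L^\infty(\Omega)$; (4) $(p\,r)(x_j^+)+(p\,r)(x_j^-)\neq 0$ for every $j\in\{1,\dots,m\}$. Consider the equation $-(p\,y')'+q\,y=\lambda\,w\,y$ on $\Omega$ with either the Dirichlet boundary condition $y(a)=y(b)=0$ or the Neumann boundary condition $y'(a)=y'(b)=0$, and call $\lambda\in\mathbb{C}$ an eigenvalue if there is a nontrivial solution satisfying the chosen boundary condition. Then, for each of these two boundary conditions, the eigenvalues in the open left half-plane form a bounded set: there exists $R_0>0$ such that every eigenvalue $\lambda$ with $\operatorname{Re}(\lambda)<0$ satisfies $|\lambda|<R_0$.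
   Context: A solution of $-(py')'+qy=\lambda wy$ on $\Omega$ is a function $y$ with $y,\,py'\in AC(\Omega)$ (absolutely continuous on $[a,b]$) satisfying the equation almost everywhere on $\Omega$; in particular $(y,py')^T$ is continuous across each interior interface. The values $y'(a),y'(b)$ are one-sided; since $p$ has nonzero one-sided limits at the endpoints, the Neumann condition is equivalent to $(py')(a)=(py')(b)=0$. $f(x^\pm)$ denotes the one-sided limits of $f$ at $x$. All interface values of $p,r$ are one-sided limits (these exist because $p,r\in W^{2,\infty}(\Omega_j)$). At $j=m$ the limit from the right in (4) is taken via the $\ell$-periodic extension, so $(pr)(x_m^+)=(pr)(a^+)$. $W^{2,\infty}(I)$ is the Sobolev space of functions on the open interval $I$ with weak derivatives up to order 2 in $L^\infty(I)$ (identified with their continuous representatives on $\overline I$). *)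

theory Defs
  imports "HOL-Analysis.Analysis"
begin

section \<open>Function spaces\<close>

definition Linfty :: "real set \<Rightarrow> (real \<Rightarrow> complex) \<Rightarrow> bool" where
  "Linfty S f \<longleftrightarrow> f \<in> borel_measurable (lebesgue_on S) \<and>
     (\<exists>C. AE t in lebesgue_on S. norm (f t) \<le> C)"

definition test_function :: "real \<Rightarrow> real \<Rightarrow> (real \<Rightarrow> real) \<Rightarrow> bool" where
  "test_function u v \<phi> \<longleftrightarrow>
     (\<forall>k t. (deriv ^^ k) \<phi> field_differentiable at t) \<and>
     (\<exists>K. compact K \<and> K \<subseteq> {u<..<v} \<and> (\<forall>t. t \<notin> K \<longrightarrow> \<phi> t = 0))"

text \<open>The function \<open>g\<close> is a weak \<open>k\<close>-th derivative of \<open>f\<close> on the open interval from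
  \<open>u\<close> to \<open>v\<close>. This is meant for locally integrable \<open>f\<close> and \<open>g\<close>, and is only used below for
  essentially bounded ones.\<close>

definition weak_deriv ::
  "nat \<Rightarrow> real \<Rightarrow> real \<Rightarrow> (real \<Rightarrow> complex) \<Rightarrow> (real \<Rightarrow> complex) \<Rightarrow> bool" where
  "weak_deriv k u v f g \<longleftrightarrow>
     (\<forall>\<phi>. test_function u v \<phi> \<longrightarrow>
        (LINT t|lebesgue_on {u<..<v}. (deriv ^^ k) \<phi> t *\<^sub>R f t) =
        (-1) ^ k * (LINT t|lebesgue_on {u<..<v}. \<phi> t *\<^sub>R g t))"

text \<open>Membership in the Sobolev space \<open>W\<close> with exponents \<open>2\<close> and infinity on the open interval
  from \<open>u\<close> to \<open>v\<close>. Elements are identified with their continuous representatives, hence the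
  continuity clause. The values of \<open>f\<close> at \<open>u\<close> and \<open>v\<close> play no role.\<close>

definition W2infty :: "real \<Rightarrow> real \<Rightarrow> (real \<Rightarrow> complex) \<Rightarrow> bool" where
  "W2infty u v f \<longleftrightarrow> continuous_on {u<..<v} f \<and> Linfty {u<..<v} f \<and>
     (\<exists>f1 f2. Linfty {u<..<v} f1 \<and> weak_deriv 1 u v f f1 \<and>
              Linfty {u<..<v} f2 \<and> weak_deriv 2 u v f f2)"

text \<open>The continuous representative on the closed interval from \<open>u\<close> to \<open>v\<close> of a function
  given on the open interval: at \<open>u\<close> and \<open>v\<close> it takes the one-sided limits, whatever the
  values of \<open>f\<close> there, and at interior points it is \<open>f\<close> itself if \<open>f\<close> is continuous.\<close>

definition closed_rep :: "real \<Rightarrow> real \<Rightarrow> (real \<Rightarrow> complex) \<Rightarrow> real \<Rightarrow> complex" where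
  "closed_rep u v f t = Lim (at t within {u<..<v}) f"

text \<open>Absolute continuity on the closed interval from \<open>a\<close> to \<open>b\<close>. The members of a
  \<^const>\<open>division_of\<close> are nonoverlapping compact intervals \<open>k\<close> with endpoints \<open>Inf k\<close>
  and \<open>Sup k\<close>.\<close>

definition abs_cont_on :: "real \<Rightarrow> real \<Rightarrow> (real \<Rightarrow> complex) \<Rightarrow> bool" where
  "abs_cont_on a b f \<longleftrightarrow>
     (\<forall>\<epsilon>>0. \<exists>\<delta>>0. \<forall>D S. D division_of S \<and> S \<subseteq> {a..b} \<and> (\<Sum>k\<in>D. Sup k - Inf k) < \<delta> \<longrightarrow>
        (\<Sum>k\<in>D. norm (f (Sup k) - f (Inf k))) < \<epsilon>)"

text \<open>The extension with period \<open>b - a\<close> of the restriction of \<open>f\<close> to the half-open interval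
  \<open>{a..<b}\<close>.\<close>

definition periodic_ext :: "real \<Rightarrow> real \<Rightarrow> (real \<Rightarrow> 'a) \<Rightarrow> real \<Rightarrow> 'a" where
  "periodic_ext a b f t = f (t - (b - a) * of_int \<lfloor>(t - a) / (b - a)\<rfloor>)"


section \<open>The Sturm-Liouville eigenvalue problem\<close>

text \<open>Since \<open>p\<close> may jump, \<open>p * y'\<close> is only defined almost everywhere; that it is absolutely
  continuous means that it agrees almost everywhere with an absolutely continuous function
  \<open>u\<close>, the quasi-derivative of \<open>y\<close>.\<close>

definition sl_solution :: "real \<Rightarrow> real \<Rightarrow> (real \<Rightarrow> complex) \<Rightarrow> (real \<Rightarrow> complex) \<Rightarrow>
    (real \<Rightarrow> complex) \<Rightarrow> complex \<Rightarrow> (real \<Rightarrow> complex) \<Rightarrow> bool" where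
  "sl_solution a b p q w \<mu> y \<longleftrightarrow> abs_cont_on a b y \<and>
     (\<exists>u. abs_cont_on a b u \<and>
        (AE t in lebesgue_on {a..b}. y differentiable (at t) \<and>
            u t = p t * vector_derivative y (at t)) \<and>
        (AE t in lebesgue_on {a..b}. u differentiable (at t) \<and>
            - vector_derivative u (at t) + q t * y t = \<mu> * w t * y t))"

definition dirichlet_bc :: "real \<Rightarrow> real \<Rightarrow> (real \<Rightarrow> complex) \<Rightarrow> bool" where
  "dirichlet_bc a b y \<longleftrightarrow> y a = 0 \<and> y b = 0"

definition neumann_bc :: "real \<Rightarrow> real \<Rightarrow> (real \<Rightarrow> complex) \<Rightarrow> bool" where
  "neumann_bc a b y \<longleftrightarrow> (y has_vector_derivative 0) (at a within {a..b}) \<and>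
     (y has_vector_derivative 0) (at b within {a..b})"

definition sl_eigenvalue :: "(real \<Rightarrow> real \<Rightarrow> (real \<Rightarrow> complex) \<Rightarrow> bool) \<Rightarrow> real \<Rightarrow> real \<Rightarrow>
    (real \<Rightarrow> complex) \<Rightarrow> (real \<Rightarrow> complex) \<Rightarrow> (real \<Rightarrow> complex) \<Rightarrow> complex \<Rightarrow> bool" where
  "sl_eigenvalue bc a b p q w \<mu> \<longleftrightarrow>
     (\<exists>y. sl_solution a b p q w \<mu> y \<and> bc a b y \<and> (\<exists>t\<in>{a..b}. y t \<noteq> 0))"

end

theory Submission
  imports Defs
begin

text \<open>The reason is that for a spectral parameter \<open>\<mu>\<close> in the left half-plane with large modulus the solutions
grow so fast from \<open>a\<close> to \<open>b\<close> that the boundary condition at \<open>b\<close> cannot hold. Put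
\<open>\<kappa> = csqrt (- \<mu>)\<close>, so that \<open>Re \<kappa>\<close> is at least half the modulus of \<open>\<kappa>\<close>. Write
\<open>U\<close> for the quasi-derivative of \<open>y\<close> and \<open>c\<close> for the product of \<open>p\<close> and \<open>r\<close>. With \<open>V = U / (\<kappa> c)\<close>
the equation on one subinterval becomes \<open>y' = \<kappa> r V\<close>, \<open>V' = \<kappa> r y\<close> up to terms linear in \<open>y\<close> and \<open>V\<close>
whose coefficients stay bounded as \<open>\<kappa>\<close> grows, so \<open>P = y + V\<close> grows and \<open>M = y - V\<close> decays at the rate \<open>\<kappa> r\<close>.

Consequently a bound \<open>norm M \<le> A * norm P\<close> at the left end of a subinterval turns into
\<open>norm M \<le> \<epsilon> * norm P\<close> at its right end, once the modulus of \<open>\<kappa>\<close> is large, with arbitrary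
\<open>A\<close> and \<open>\<epsilon>\<close> (\<open>segment_contraction\<close>). This is shown with the quadratic form
\<open>norm M ^ 2 - B * norm P ^ 2\<close>, whose weight \<open>B\<close> decreases linearly along the subinterval: the form is
nonincreasing when the growth rate is large (\<open>cone_contraction\<close>).

At an interface \<open>y\<close> and \<open>U\<close> are continuous while \<open>c\<close> jumps from \<open>c\<close> to \<open>c'\<close>. If the decaying
component is small compared to the growing one, then the new growing component is close to
\<open>(1 + c / c') * P / 2\<close>. The nondegeneracy condition at the interface says precisely that this factor does not
vanish, so some bound \<open>norm M \<le> A * norm P\<close> holds again on the other side (\<open>in_cone_interface\<close>).
Starting from \<open>norm M = norm P\<close> at \<open>a\<close>, which is what either boundary condition gives, one
arrives at \<open>norm M \<le> norm P / 2\<close> at \<open>b\<close> (\<open>iterated_cone_contraction\<close>). The boundary condition at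
\<open>b\<close> demands \<open>norm M = norm P\<close> there, so \<open>y\<close> and \<open>U\<close> both vanish at \<open>b\<close>, and \<open>y\<close> is trivial by
uniqueness for the initial value problem (\<open>linear_system_uniqueness\<close>).

Two analytic tools support this. The differential inequalities hold only almost everywhere, so a
mean value inequality for absolutely continuous functions is needed (\<open>abs_cont_on_mean_value\<close>). The
coefficients are given by weak derivatives; testing with smooth approximations of indicator functions
shows that they are Lipschitz (\<open>weak_deriv_bounded_imp_lipschitz\<close>). To form the derivative of \<open>V\<close>
one replaces the Lipschitz function \<open>c\<close> by its average over a window of length \<open>1 / norm \<kappa>\<close>
(\<open>lipschitz_smoothing\<close>).\<close>

section \<open>Absolutely continuous functions and almost everywhere derivatives\<close>

lemma AE_lebesgue_on_not_in_finite:
  fixes F :: "real set"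
  assumes "finite F" "S \<in> sets lebesgue"
  shows "AE x in lebesgue_on S. x \<notin> F"
proof -
  have "F \<in> null_sets lebesgue" using assms(1) by (simp add: negligible_finite flip: negligible_iff_null_sets)
  then have "AE x in lebesgue. x \<notin> F" by (rule AE_not_in)
  then show ?thesis using assms(2) by (subst AE_restrict_space_iff) auto
qed

lemma AE_lebesgue_on_subset:
  assumes "AE t in lebesgue_on T. P t" "S \<subseteq> T" "S \<in> sets lebesgue" "T \<in> sets lebesgue"
  shows "AE t in lebesgue_on S. P t"
proof -
  have "AE t in lebesgue. t \<in> T \<longrightarrow> P t" using assms by (subst (asm) AE_restrict_space_iff) auto
  then have "AE t in lebesgue. t \<in> S \<longrightarrow> P t" by eventually_elim (use assms(2) in auto)
  then show ?thesis using assms(3) by (subst AE_restrict_space_iff) auto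
qed

text \<open>The mean value inequality survives an exceptional null set because absolute continuity makes the
intervals near that set contribute arbitrarily little. On a fine tagged division, the intervals with
a good tag obey the bound of the derivative, and the others lie in an open set of small measure.\<close>

lemma abs_cont_on_mean_value:
  assumes ac: "abs_cont_on a b f" and st: "a \<le> s" "s \<le> t" "t \<le> b" and K: "K \<ge> 0"
    and ae: "AE x in lebesgue_on {s..t}. \<exists>d. (f has_vector_derivative d) (at x) \<and> norm d \<le> K"
  shows "norm (f t - f s) \<le> K * (t - s)"
proof (rule field_le_epsilon)
  fix \<epsilon>' :: real assume "\<epsilon>' > 0"
  define \<epsilon> where "\<epsilon> = \<epsilon>' / (t - s + 1)"
  have \<epsilon>: "\<epsilon> > 0" using \<open>\<epsilon>' > 0\<close> st by (auto simp: \<epsilon>_def)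
  have "\<epsilon> * (t - s + 1) = \<epsilon>'" using st by (simp add: \<epsilon>_def)
  then have \<epsilon>2: "\<epsilon> * (t - s) + \<epsilon> = \<epsilon>'" by (simp add: algebra_simps)
  \<comment> \<open>\<open>N\<close> is the exceptional null set; it is covered by an open set \<open>U\<close> whose measure is below the
    threshold that absolute continuity provides for \<open>\<epsilon>\<close>\<close>
  define P where "P = (\<lambda>x. \<exists>d. (f has_vector_derivative d) (at x) \<and> norm d \<le> K)"
  define N where "N = {x \<in> {s..t}. \<not> P x}"
  have "AE x in lebesgue. x \<in> {s..t} \<longrightarrow> P x"
    using ae by (subst (asm) AE_restrict_space_iff) (auto simp: P_def)
  then have Nnull: "N \<in> null_sets lebesgue"
    unfolding eventually_ae_filter
    by (auto simp: negligible_iff_null_sets[symmetric] N_def elim!: negligible_subset)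
  obtain \<delta> where \<delta>: "\<delta> > 0" and ac': "\<And>D S. D division_of S \<Longrightarrow> S \<subseteq> {a..b} \<Longrightarrow>
      (\<Sum>k\<in>D. Sup k - Inf k) < \<delta> \<Longrightarrow> (\<Sum>k\<in>D. norm (f (Sup k) - f (Inf k))) < \<epsilon>"
    using ac \<epsilon>(1) unfolding abs_cont_on_def by metis
  have "N \<in> sets lebesgue" using Nnull by auto
  then obtain U where U: "open U" "N \<subseteq> U" "U - N \<in> lmeasurable" "emeasure lebesgue (U - N) < ennreal \<delta>"
    using sets_lebesgue_outer_open[OF _ \<delta>] by metis
  have Us: "U \<in> sets lebesgue" using U(1) by (metis borel_open sets_completionI_sets sets_lborel)
  have emU: "emeasure lebesgue U < ennreal \<delta>"
    using U Nnull Us by (simp add: emeasure_Diff_null_set)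
  \<comment> \<open>at a good point, differentiability controls every small interval that contains the point,
    also when the point is not an endpoint\<close>
  have straddle: "\<exists>r>0. \<forall>\<alpha> \<beta>. \<alpha> \<le> x \<and> x \<le> \<beta> \<and> {\<alpha>..\<beta>} \<subseteq> ball x r \<longrightarrow>
        norm (f \<beta> - f \<alpha>) \<le> (K + \<epsilon>) * (\<beta> - \<alpha>)" if "P x" for x
  proof -
    obtain d where d: "(f has_vector_derivative d) (at x)" "norm d \<le> K"
      using \<open>P x\<close> by (auto simp: P_def)
    then obtain r where r: "r > 0" "\<And>y. norm (y - x) < r \<Longrightarrow>
         norm (f y - f x - (y - x) *\<^sub>R d) \<le> \<epsilon> * norm (y - x)"
      using \<epsilon> unfolding has_vector_derivative_def has_derivative_at_alt by metis
    have "norm (f \<beta> - f \<alpha>) \<le> (K + \<epsilon>) * (\<beta> - \<alpha>)"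
      if "\<alpha> \<le> x" "x \<le> \<beta>" "{\<alpha>..\<beta>} \<subseteq> ball x r" for \<alpha> \<beta>
    proof -
      have "\<alpha> \<in> {\<alpha>..\<beta>}" "\<beta> \<in> {\<alpha>..\<beta>}" using that by auto
      then have "\<alpha> \<in> ball x r" "\<beta> \<in> ball x r" using that(3) by blast+
      then have A: "norm (f \<beta> - f x - (\<beta> - x) *\<^sub>R d) \<le> \<epsilon> * (\<beta> - x)"
        and B: "norm (f \<alpha> - f x - (\<alpha> - x) *\<^sub>R d) \<le> \<epsilon> * (x - \<alpha>)"
        using r(2)[of \<alpha>] r(2)[of \<beta>] that by (auto simp: dist_norm abs_minus_commute)
      have "f \<beta> - f \<alpha> = (f \<beta> - f x - (\<beta> - x) *\<^sub>R d) - (f \<alpha> - f x - (\<alpha> - x) *\<^sub>R d) + (\<beta> - \<alpha>) *\<^sub>R d"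
        by (simp add: algebra_simps)
      then have "norm (f \<beta> - f \<alpha>) \<le> norm (f \<beta> - f x - (\<beta> - x) *\<^sub>R d)
          + norm (f \<alpha> - f x - (\<alpha> - x) *\<^sub>R d) + norm ((\<beta> - \<alpha>) *\<^sub>R d)"
        by (metis norm_triangle_le norm_triangle_ineq4 add_mono order_refl)
      also have "\<dots> \<le> \<epsilon> * (\<beta> - x) + \<epsilon> * (x - \<alpha>) + (\<beta> - \<alpha>) * K"
        using A B that d(2) by (intro add_mono) (auto intro: mult_left_mono)
      finally show ?thesis by (simp add: algebra_simps)
    qed
    then show ?thesis using r(1) by blast
  qed
  then obtain R where R: "\<And>x. P x \<Longrightarrow> R x > 0" "\<And>x \<alpha> \<beta>. P x \<Longrightarrow> \<alpha> \<le> x \<Longrightarrow> x \<le> \<beta> \<Longrightarrow>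
      {\<alpha>..\<beta>} \<subseteq> ball x (R x) \<Longrightarrow> norm (f \<beta> - f \<alpha>) \<le> (K + \<epsilon>) * (\<beta> - \<alpha>)"
    by metis
  \<comment> \<open>intervals tagged in \<open>N\<close> are forced into \<open>U\<close>, the others into the range of the straddle estimate\<close>
  define \<gamma> where "\<gamma> x = (if x \<in> N then U else ball x (if P x then R x else 1))" for x
  have "gauge \<gamma>" using U R(1) by (auto simp: gauge_def \<gamma>_def)
  then obtain p where p: "p tagged_division_of {s..t}" "\<gamma> fine p"
    using fine_division_exists_real by blast
  have fin: "finite p" using p by auto
  have pint: "\<exists>\<alpha> \<beta>. k = {\<alpha>..\<beta>} \<and> \<alpha> \<le> x \<and> x \<le> \<beta> \<and> s \<le> \<alpha> \<and> \<beta> \<le> t \<and> Sup k = \<beta> \<and> Inf k = \<alpha>" if xk: "(x,k) \<in> p" for x k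
  proof -
    obtain \<alpha> \<beta> where k: "k = {\<alpha>..\<beta>}" using tagged_division_ofD(4)[OF p(1) xk] by auto
    have "x \<in> k" "k \<subseteq> {s..t}" using tagged_division_ofD(2,3)[OF p(1) xk] by auto
    then show ?thesis using k by auto
  qed
  define pN where "pN = {(x,k) \<in> p. x \<in> N}"
  have pNp: "pN \<subseteq> p" by (auto simp: pN_def)
  have pNt: "pN tagged_partial_division_of {s..t}"
    using p(1) pNp by (meson tagged_division_of tagged_division_of_def tagged_partial_division_subset)
  define D where "D = snd ` pN"
  have D: "D division_of \<Union>D" unfolding D_def
    by (rule partial_division_of_tagged_division[OF pNt])
  have Dsub: "\<Union>D \<subseteq> U" "\<Union>D \<subseteq> {a..b}" 
    using fineD[OF p(2)] pint st by (force simp: D_def pN_def \<gamma>_def)+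
  have Dint: "\<exists>\<alpha> \<beta>. k = {\<alpha>..\<beta>} \<and> \<alpha> \<le> \<beta> \<and> Sup k = \<beta> \<and> Inf k = \<alpha>" if "k \<in> D" for k
    using that pint unfolding D_def pN_def by fastforce
  have "(\<Sum>k\<in>D. Sup k - Inf k) = (\<Sum>k\<in>D. measure lebesgue k)"
  proof (rule sum.cong[OF refl])
    fix k assume "k \<in> D"
    then obtain \<alpha> \<beta> where k: "k = {\<alpha>..\<beta>}" "\<alpha> \<le> \<beta>" using Dint by blast
    show "Sup k - Inf k = measure lebesgue k" unfolding k(1) using k(2) by simp
  qed
  also have "\<dots> = measure lebesgue (\<Union>D)" by (rule content_division[OF D])
  also have "\<dots> < \<delta>"
  proof -
    have "emeasure lebesgue (\<Union>D) < ennreal \<delta>"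
      using emeasure_mono[OF Dsub(1) Us] emU by (rule le_less_trans)
    then show ?thesis using \<delta>
      by (metis emeasure_eq_measure2 ennreal_less_iff lmeasurable_division[OF D] measure_nonneg)
  qed
  finally have small: "(\<Sum>k\<in>D. norm (f (Sup k) - f (Inf k))) < \<epsilon>"
    using ac' D Dsub by blast
  have sumN: "(\<Sum>(x,k)\<in>pN. norm (f (Sup k) - f (Inf k))) < \<epsilon>"
  proof -
    \<comment> \<open>\<open>Sup {}\<close> and \<open>Inf {}\<close> are unspecified reals, so the empty set gets the value \<open>0\<close> explicitly\<close>
    define \<psi> where "\<psi> k = (if k = {} then 0 else norm (f (Sup k) - f (Inf k)))" for k
    have "(\<Sum>(x,k)\<in>pN. norm (f (Sup k) - f (Inf k))) = (\<Sum>(x,k)\<in>pN. \<psi> k)"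
      using tagged_division_ofD(2)[OF p(1)] by (intro sum.cong) (fastforce simp: \<psi>_def pN_def)+
    also have "\<dots> = sum \<psi> (snd ` pN)"
    proof (rule sum.over_tagged_division_lemma[OF tagged_partial_division_of_Union_self[OF pNt]])
      fix u v :: real assume "box u v = {}"
      then have "v \<le> u" by (simp add: box_real)
      then show "\<psi> (cbox u v) = 0"
        by (cases "u = v") (auto simp: \<psi>_def)
    qed
    also have "\<dots> = (\<Sum>k\<in>D. norm (f (Sup k) - f (Inf k)))"
      unfolding D_def[symmetric] using division_ofD(3)[OF D] by (intro sum.cong) (auto simp: \<psi>_def)
    finally have "(\<Sum>(x,k)\<in>pN. norm (f (Sup k) - f (Inf k))) = (\<Sum>k\<in>D. norm (f (Sup k) - f (Inf k)))" .
    then show ?thesis using small by simp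
  qed
  have good: "norm (f (Sup k) - f (Inf k)) \<le> (K + \<epsilon>) * (Sup k - Inf k)" if xk: "(x,k) \<in> p - pN" for x k
  proof -
    obtain \<alpha> \<beta> where k: "k = {\<alpha>..\<beta>}" "\<alpha> \<le> x" "x \<le> \<beta>" "s \<le> \<alpha>" "\<beta> \<le> t" "Sup k = \<beta>" "Inf k = \<alpha>"
      using pint xk by blast
    have "x \<notin> N" using xk by (auto simp: pN_def)
    moreover have "x \<in> {s..t}" using k by auto
    ultimately have "P x" by (auto simp: N_def)
    have "k \<subseteq> \<gamma> x" using fineD[OF p(2)] xk by blast
    then have "k \<subseteq> ball x (R x)" using \<open>P x\<close> \<open>x \<notin> N\<close> by (simp add: \<gamma>_def)
    then show ?thesis using \<open>P x\<close> R(2)[of x \<alpha> \<beta>] k by auto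
  qed
  have nonneg: "0 \<le> Sup k - Inf k" if "(x,k) \<in> p" for x k using pint[OF that] by auto
  have "f t - f s = (\<Sum>(x,k)\<in>p. f (Sup k) - f (Inf k))"
    using additive_tagged_division_1[OF st(2) p(1), of f] by simp
  also have "norm \<dots> \<le> (\<Sum>(x,k)\<in>p. norm (f (Sup k) - f (Inf k)))"
    by (rule order_trans[OF norm_sum]) (auto intro!: sum_mono)
  also have "\<dots> = (\<Sum>(x,k)\<in>p - pN. norm (f (Sup k) - f (Inf k))) + (\<Sum>(x,k)\<in>pN. norm (f (Sup k) - f (Inf k)))"
    using fin pNp by (rule sum.subset_diff[rotated])
  also have "(\<Sum>(x,k)\<in>p - pN. norm (f (Sup k) - f (Inf k))) \<le> (\<Sum>(x,k)\<in>p - pN. (K + \<epsilon>) * (Sup k - Inf k))"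
    using good by (intro sum_mono) auto
  also have "\<dots> \<le> (\<Sum>(x,k)\<in>p. (K + \<epsilon>) * (Sup k - Inf k))"
    using fin K \<epsilon> nonneg by (intro sum_mono2) (auto intro!: mult_nonneg_nonneg)
  also have "\<dots> = (K + \<epsilon>) * (\<Sum>(x,k)\<in>p. (Sup k - Inf k))"
    by (simp add: sum_distrib_left case_prod_unfold)
  also have "(\<Sum>(x,k)\<in>p. (Sup k - Inf k)) = t - s"
    using additive_tagged_division_1[OF st(2) p(1), of "\<lambda>x. x"] by simp
  finally have "norm (f t - f s) \<le> (K + \<epsilon>) * (t - s) + \<epsilon>" using sumN by simp
  then show "norm (f t - f s) \<le> K * (t - s) + \<epsilon>'" using \<epsilon>2 by (simp add: algebra_simps)
qed

lemma abs_cont_on_imp_continuous_on: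
  assumes f: "abs_cont_on a b f"
  shows "continuous_on {a..b} f"
  unfolding continuous_on_iff
proof (intro ballI allI impI)
  fix x \<epsilon> assume x: "x \<in> {a..b}" and "(\<epsilon>::real) > 0"
  then obtain \<delta> where \<delta>: "\<delta> > 0" and ac: "\<And>D S. D division_of S \<and> S \<subseteq> {a..b} \<and>
      (\<Sum>k\<in>D. Sup k - Inf k) < \<delta> \<Longrightarrow> (\<Sum>k\<in>D. norm (f (Sup k) - f (Inf k))) < \<epsilon>"
    using f unfolding abs_cont_on_def by metis
  have close: "norm (f v - f u) < \<epsilon>" if "u \<in> {a..b}" "v \<in> {a..b}" "u \<le> v" "v - u < \<delta>" for u v
  proof -
    have "{{u..v}} division_of {u..v}"
      using division_of_self[of u v] that(3) by auto
    then show ?thesis using ac[of "{{u..v}}" "{u..v}"] that by auto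
  qed
  show "\<exists>d>0. \<forall>x'\<in>{a..b}. dist x' x < d \<longrightarrow> dist (f x') (f x) < \<epsilon>"
  proof (intro exI[of _ \<delta>] conjI \<delta> ballI impI)
    fix x' assume "x' \<in> {a..b}" "dist x' x < \<delta>"
    then show "dist (f x') (f x) < \<epsilon>"
      using close[of x x'] close[of x' x] x by (cases "x \<le> x'") (auto simp: dist_norm norm_minus_commute)
  qed
qed

lemma abs_cont_on_imp_lipschitz:
  assumes f: "abs_cont_on a b f" and K: "K \<ge> 0"
    and ae: "AE x in lebesgue_on {a..b}. \<exists>d. (f has_vector_derivative d) (at x) \<and> norm d \<le> K"
  shows "K-lipschitz_on {a..b} f"
proof (rule lipschitz_on_leI)
  fix s t assume st: "s \<in> {a..b}" "t \<in> {a..b}" "s \<le> t"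
  have "AE x in lebesgue_on {s..t}. \<exists>d. (f has_vector_derivative d) (at x) \<and> norm d \<le> K"
    by (rule AE_lebesgue_on_subset[OF ae]) (use st in auto)
  then have "norm (f t - f s) \<le> K * (t - s)"
    using st by (intro abs_cont_on_mean_value[OF f _ _ _ K]) auto
  then show "dist (f s) (f t) \<le> K * dist s t" using st by (simp add: dist_norm norm_minus_commute)
qed (rule K)

lemma lipschitz_imp_abs_cont_on:
  assumes "L-lipschitz_on {a..b} f"
  shows "abs_cont_on a b f"
  unfolding abs_cont_on_def
proof (intro allI impI)
  fix \<epsilon> :: real assume "\<epsilon> > 0"
  have L: "L \<ge> 0" using assms by (rule lipschitz_on_nonneg)
  show "\<exists>\<delta>>0. \<forall>D S. D division_of S \<and> S \<subseteq> {a..b} \<and> (\<Sum>k\<in>D. Sup k - Inf k) < \<delta> \<longrightarrow>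
        (\<Sum>k\<in>D. norm (f (Sup k) - f (Inf k))) < \<epsilon>"
  proof (intro exI[of _ "\<epsilon> / (L + 1)"] conjI allI impI)
    show "\<epsilon> / (L + 1) > 0" using \<open>\<epsilon> > 0\<close> L by simp
    fix D S assume D: "D division_of S \<and> S \<subseteq> {a..b} \<and> (\<Sum>k\<in>D. Sup k - Inf k) < \<epsilon> / (L + 1)"
    have k: "0 \<le> Sup k - Inf k \<and> norm (f (Sup k) - f (Inf k)) \<le> L * (Sup k - Inf k)" if kD: "k \<in> D" for k
    proof -
      obtain u v where uv: "k = {u..v}" using division_ofD(4)[of D S k] D kD by auto
      moreover have "k \<noteq> {}" "k \<subseteq> {a..b}" using division_ofD(2,3)[of D S k] D kD by auto
      ultimately have "u \<le> v" "u \<in> {a..b}" "v \<in> {a..b}" by auto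
      then show ?thesis using lipschitz_on_normD[OF assms, of v u] uv by simp
    qed
    have "(\<Sum>k\<in>D. norm (f (Sup k) - f (Inf k))) \<le> (\<Sum>k\<in>D. L * (Sup k - Inf k))"
      using k by (intro sum_mono) auto
    also have "\<dots> \<le> (L + 1) * (\<Sum>k\<in>D. Sup k - Inf k)"
      using k L by (auto simp: sum_distrib_left[symmetric] intro!: mult_right_mono sum_nonneg)
    also have "\<dots> < \<epsilon>" using D L by (simp add: pos_less_divide_eq mult.commute)
    finally show "(\<Sum>k\<in>D. norm (f (Sup k) - f (Inf k))) < \<epsilon>" .
  qed
qed

lemma lipschitz_on_derivative_bound:
  fixes f :: "real \<Rightarrow> real"
  assumes lip: "L-lipschitz_on {s..t} f" and x: "x \<in> {s<..<t}" and d: "(f has_real_derivative d) (at x)"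
  shows "\<bar>d\<bar> \<le> L"
proof (rule tendsto_upperbound)
  show "((\<lambda>y. \<bar>(f y - f x) / (y - x)\<bar>) \<longlongrightarrow> \<bar>d\<bar>) (at x)"
    using d by (intro tendsto_rabs) (simp add: has_field_derivative_iff)
  have "\<forall>\<^sub>F y in at x. y \<in> {s<..<t} - {x}"
    using x by (intro eventually_at_in_open) auto
  then show "\<forall>\<^sub>F y in at x. \<bar>(f y - f x) / (y - x)\<bar> \<le> L"
  proof eventually_elim
    case (elim y)
    then have "\<bar>f y - f x\<bar> \<le> L * \<bar>y - x\<bar>" using lipschitz_on_normD[OF lip, of y x] x by auto
    then show ?case using elim by (simp add: pos_divide_le_eq)
  qed
qed simp

text \<open>The sign version of the mean value inequality is reduced to the norm version: the Lipschitz constant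
also bounds the derivative from below, so after adding a linear function the bound is symmetric.\<close>

lemma lipschitz_on_decreasing:
  fixes f :: "real \<Rightarrow> real"
  assumes lip: "L-lipschitz_on {s..t} f" and st: "s \<le> t"
    and ae: "AE x in lebesgue_on {s..t}. \<exists>d. (f has_real_derivative d) (at x) \<and> d \<le> 0"
  shows "f t \<le> f s"
proof -
  have L: "L \<ge> 0" using lip by (rule lipschitz_on_nonneg)
  \<comment> \<open>the tilt moves the derivative from the interval from \<open>-L\<close> to \<open>0\<close> into the symmetric one of radius \<open>L / 2\<close>\<close>
  define g :: "real \<Rightarrow> complex" where "g x = of_real (f x + L / 2 * x)" for x
  have "(L + L / 2)-lipschitz_on {s..t} g"
  proof (rule lipschitz_onI)
    fix x y assume xy: "x \<in> {s..t}" "y \<in> {s..t}"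
    have "g x - g y = of_real ((f x - f y) + L / 2 * (x - y))" unfolding g_def of_real_diff[symmetric] by (simp add: right_diff_distrib diff_divide_distrib)
    then have "dist (g x) (g y) = \<bar>(f x - f y) + L / 2 * (x - y)\<bar>"
      by (simp only: dist_norm norm_of_real)
    also have "\<dots> \<le> L * \<bar>x - y\<bar> + L / 2 * \<bar>x - y\<bar>"
      using lipschitz_on_normD[OF lip xy] L
      by (intro abs_triangle_ineq[THEN order_trans] add_mono) (auto simp: abs_mult)
    finally show "dist (g x) (g y) \<le> (L + L / 2) * dist x y" by (simp add: dist_norm algebra_simps)
  qed (use L in auto)
  then have "abs_cont_on s t g" by (rule lipschitz_imp_abs_cont_on)
  moreover have "AE x in lebesgue_on {s..t}. \<exists>d. (g has_vector_derivative d) (at x) \<and> norm d \<le> L / 2"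
  proof -
    have "AE x in lebesgue_on {s..t}. x \<notin> {s, t}" by (rule AE_lebesgue_on_not_in_finite) auto
    moreover have "AE x in lebesgue_on {s..t}. x \<in> {s..t}" by (simp add: AE_restrict_space_iff)
    ultimately show ?thesis using ae
    proof eventually_elim
      case (elim x)
      then obtain d where d: "(f has_real_derivative d) (at x)" "d \<le> 0" and x: "x \<in> {s<..<t}" by auto
      have "\<bar>d\<bar> \<le> L" by (rule lipschitz_on_derivative_bound[OF lip x d(1)])
      then have "norm (of_real (d + L / 2) :: complex) \<le> L / 2" using d(2) by (simp only: norm_of_real)
      moreover have "((\<lambda>x. f x + L / 2 * x) has_real_derivative d + L / 2) (at x)"
        using d(1) by (auto intro!: derivative_eq_intros)
      then have "(g has_vector_derivative of_real (d + L / 2)) (at x)"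
        unfolding g_def by (rule has_vector_derivative_of_real)
      ultimately show ?case by blast
    qed
  qed
  ultimately have "norm (g t - g s) \<le> L / 2 * (t - s)"
    by (rule abs_cont_on_mean_value[OF _ order_refl st order_refl, where K = "L / 2", OF _ divide_nonneg_nonneg[OF L zero_le_numeral]])
  moreover have "g t - g s = of_real (f t - f s + L / 2 * (t - s))"
    unfolding g_def of_real_diff[symmetric] by (simp add: right_diff_distrib diff_divide_distrib)
  ultimately have "\<bar>f t - f s + L / 2 * (t - s)\<bar> \<le> L / 2 * (t - s)"
    by (simp only: norm_of_real)
  then show ?thesis by linarith
qed

text \<open>If the almost everywhere derivative has a continuous representative, then it is the derivative
everywhere, one-sided at the endpoints. Applied to a solution, this links the one-sided derivatives in
the Neumann condition to the quasi-derivative.\<close>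

lemma has_vector_derivative_of_ae_continuous:
  fixes y g :: "real \<Rightarrow> complex"
  assumes y: "L-lipschitz_on {u..v} y" and g: "continuous_on {u..v} g"
    and ae: "AE t in lebesgue_on {u..v}. (y has_vector_derivative g t) (at t)"
    and t: "t \<in> {u..v}"
  shows "(y has_vector_derivative g t) (at t within {u..v})"
proof -
  define G where "G t = integral {u..t} g" for t
  have G: "(G has_vector_derivative g t) (at t within {u..v})" if "t \<in> {u..v}" for t
    unfolding G_def by (rule integral_has_vector_derivative[OF g that])
  have "bounded (g ` {u..v})" by (intro compact_imp_bounded compact_continuous_image g) auto
  then obtain B where B: "\<forall>t\<in>{u..v}. norm (g t) \<le> B" unfolding bounded_iff by auto
  have B0: "B \<ge> 0" using B t norm_ge_zero order_trans by blast
  have "B-lipschitz_on {u..v} G"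
  proof (rule bounded_derivative_imp_lipschitz)
    fix t assume "t \<in> {u..v}"
    then show "(G has_derivative (\<lambda>h. h *\<^sub>R g t)) (at t within {u..v})"
      using G unfolding has_vector_derivative_def by blast
    show "onorm (\<lambda>h. h *\<^sub>R g t) \<le> B"
      using B \<open>t \<in> _\<close> B0 by (intro onorm_bound) (auto simp: mult.commute[of _ "norm (g t)"] intro!: mult_right_mono)
  qed (use B0 in auto)
  from lipschitz_on_diff[OF y this] have "abs_cont_on u v (\<lambda>t. y t - G t)"
    by (rule lipschitz_imp_abs_cont_on)
  moreover have "AE t in lebesgue_on {u..v}. \<exists>d. ((\<lambda>t. y t - G t) has_vector_derivative d) (at t) \<and> norm d \<le> 0"
  proof -
    have "AE t in lebesgue_on {u..v}. t \<notin> {u, v}" by (rule AE_lebesgue_on_not_in_finite) auto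
    moreover have "AE t in lebesgue_on {u..v}. t \<in> {u..v}" by (simp add: AE_restrict_space_iff)
    ultimately show ?thesis using ae
    proof eventually_elim
      case (elim t)
      then have "at t within {u..v} = at t" by (intro at_within_interior) auto
      then have "((\<lambda>t. y t - G t) has_vector_derivative (g t - g t)) (at t)"
        using elim G[of t] by (intro has_vector_derivative_diff) auto
      then show ?case by (intro exI[of _ 0]) simp
    qed
  qed
  ultimately have "0-lipschitz_on {u..v} (\<lambda>t. y t - G t)"
    by (intro abs_cont_on_imp_lipschitz) auto
  then have "y s = (y t - G t) + G s" if "s \<in> {u..v}" for s
    using lipschitz_on_normD[of 0 "{u..v}" "\<lambda>t. y t - G t" s t] that t by (simp add: algebra_simps)
  moreover have "((\<lambda>s. (y t - G t) + G s) has_vector_derivative g t) (at t within {u..v})"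
    using has_vector_derivative_add[OF has_vector_derivative_const G[OF t]] by simp
  ultimately show ?thesis
    using t has_vector_derivative_transform[of t "{u..v}" y "\<lambda>s. (y t - G t) + G s" "g t"] by blast
qed

section \<open>A smooth step function\<close>

text \<open>
The derivatives of \<open>exp (- 1 / t)\<close>, continued by \<open>0\<close>, are linear combinations of the following functions.
\<close>

definition flat_exp :: "nat \<Rightarrow> real \<Rightarrow> real" where
  "flat_exp n t = (if t > 0 then (1 / t) ^ n * exp (- (1 / t)) else 0)"

lemma flat_exp_tendsto_0: "((\<lambda>t. flat_exp n t) \<longlongrightarrow> 0) (at 0)"
proof -
  have "((\<lambda>t. (inverse t) ^ n / exp (inverse t)) \<longlongrightarrow> (0::real)) (at_right 0)"
    by (rule filterlim_compose[OF tendsto_power_div_exp_0 filterlim_inverse_at_top_right])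
  then have "(flat_exp n \<longlongrightarrow> 0) (at_right 0)"
    by (rule Lim_transform_eventually)
       (auto simp: flat_exp_def eventually_at_right_field exp_minus field_simps intro!: exI[of _ 1])
  moreover have "(flat_exp n \<longlongrightarrow> 0) (at_left 0)"
    by (rule Lim_transform_eventually[OF tendsto_const])
       (auto simp: flat_exp_def eventually_at_left_field intro!: exI[of _ "-1"])
  ultimately show ?thesis by (simp add: filterlim_split_at)
qed

lemma flat_exp_deriv:
  "(flat_exp n has_real_derivative (flat_exp (n + 2) t - real n * flat_exp (n + 1) t)) (at t)"
proof (cases t "0::real" rule: linorder_cases)
  case less
  have "((\<lambda>_. 0) has_real_derivative 0) (at t)" by simp
  then have "(flat_exp n has_real_derivative 0) (at t)"
    by (rule has_field_derivative_transform_within_open[of _ _ _ "{..<0}"]) (use less in \<open>auto simp: flat_exp_def\<close>)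
  then show ?thesis using less by (simp add: flat_exp_def)
next
  case equal
  have "((\<lambda>h. (flat_exp n (0 + h) - flat_exp n 0) / h) \<longlongrightarrow> 0) (at 0)"
    by (rule Lim_transform_eventually[OF flat_exp_tendsto_0[of "n + 1"]])
       (auto simp: flat_exp_def eventually_at_filter)
  then show ?thesis using equal by (simp add: DERIV_def flat_exp_def)
next
  case greater
  have inv: "((\<lambda>t. 1 / t) has_real_derivative - (1 / t)\<^sup>2) (at t)"
    using greater by (auto intro!: derivative_eq_intros simp: power2_eq_square)
  have pow: "((\<lambda>t. (1 / t) ^ n) has_real_derivative - real n * (1 / t) ^ (n + 1)) (at t)"
    by (rule DERIV_cong[OF DERIV_power[OF inv]], cases n) (use greater in \<open>auto simp: power2_eq_square field_simps\<close>)
  have "((\<lambda>t. (1 / t) ^ n * exp (- (1 / t))) has_real_derivative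
      (1 / t) ^ (n + 2) * exp (- (1 / t)) - real n * ((1 / t) ^ (n + 1) * exp (- (1 / t)))) (at t)"
    by (rule DERIV_cong[OF DERIV_mult[OF pow DERIV_fun_exp[OF DERIV_minus[OF inv]]]])
       (simp add: algebra_simps power2_eq_square)
  then have "(flat_exp n has_real_derivative
      (1 / t) ^ (n + 2) * exp (- (1 / t)) - real n * ((1 / t) ^ (n + 1) * exp (- (1 / t)))) (at t)"
    by (rule has_field_derivative_transform_within_open[of _ _ _ "{0<..}"]) (use greater in \<open>auto simp: flat_exp_def\<close>)
  then show ?thesis using greater by (simp add: flat_exp_def)
qed

text \<open>Smoothness is obtained from a class of functions that is closed under differentiation: a member then
has derivatives of all orders. Spelling out the class as the closure under algebraic operations avoids
any formula for higher derivatives of products and quotients.\<close>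

inductive smooth_term :: "(real \<Rightarrow> real) \<Rightarrow> bool" where
  flat: "smooth_term (flat_exp n)"
| const: "smooth_term (\<lambda>_. c)"
| add: "smooth_term f \<Longrightarrow> smooth_term g \<Longrightarrow> smooth_term (\<lambda>t. f t + g t)"
| mult: "smooth_term f \<Longrightarrow> smooth_term g \<Longrightarrow> smooth_term (\<lambda>t. f t * g t)"
| inverse: "smooth_term f \<Longrightarrow> (\<And>t. f t \<noteq> 0) \<Longrightarrow> smooth_term (\<lambda>t. inverse (f t))"
| affine: "smooth_term f \<Longrightarrow> smooth_term (\<lambda>t. f (c * t + d))"

lemma smooth_term_derivative:
  "smooth_term f \<Longrightarrow> \<exists>f'. smooth_term f' \<and> (\<forall>t. (f has_real_derivative f' t) (at t))"
proof (induction rule: smooth_term.induct)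
  case (flat n)
  have "smooth_term (\<lambda>t. flat_exp (n + 2) t + (- real n) * flat_exp (n + 1) t)"
    by (intro smooth_term.intros)
  then show ?case using flat_exp_deriv[of n] by (intro exI conjI) auto
next
  case (const c)
  then show ?case by (intro exI[of _ "\<lambda>_. 0"]) (auto intro: smooth_term.intros)
next
  case (add f g)
  then obtain f' g' where "smooth_term f'" "smooth_term g'"
    "\<And>t. (f has_real_derivative f' t) (at t)" "\<And>t. (g has_real_derivative g' t) (at t)" by blast
  then show ?case
    by (intro exI[of _ "\<lambda>t. f' t + g' t"]) (auto intro: smooth_term.intros derivative_intros)
next
  case (mult f g)
  then obtain f' g' where *: "smooth_term f'" "smooth_term g'"
    "\<And>t. (f has_real_derivative f' t) (at t)" "\<And>t. (g has_real_derivative g' t) (at t)" by blast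
  have "smooth_term (\<lambda>t. f' t * g t + g' t * f t)" using * mult by (intro smooth_term.intros)
  then show ?case using * by (intro exI[of _ "\<lambda>t. f' t * g t + g' t * f t"] conjI allI DERIV_mult) auto
next
  case (inverse f)
  then obtain f' where *: "smooth_term f'" "\<And>t. (f has_real_derivative f' t) (at t)" by blast
  have "smooth_term (\<lambda>t. (- 1) * (f' t * (inverse (f t) * inverse (f t))))"
    using * inverse by (intro smooth_term.intros)
  moreover have "((\<lambda>t. inverse (f t)) has_real_derivative (- 1) * (f' t * (inverse (f t) * inverse (f t)))) (at t)" for t
    using DERIV_inverse_fun[OF *(2) inverse(2)] by (simp add: power2_eq_square)
  ultimately show ?case by blast
next
  case (affine f c d)
  then obtain f' where *: "smooth_term f'" "\<And>t. (f has_real_derivative f' t) (at t)" by blast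
  have "smooth_term (\<lambda>t. f' (c * t + d) * c)" using * by (intro smooth_term.intros)
  moreover have "((\<lambda>t. f (c * t + d)) has_real_derivative f' (c * t + d) * c) (at t)" for t
    by (rule DERIV_chain2[OF *(2)]) (auto intro!: derivative_eq_intros)
  ultimately show ?case by blast
qed

lemma smooth_term_deriv: "smooth_term f \<Longrightarrow> smooth_term (deriv f)"
proof -
  assume "smooth_term f"
  then obtain f' where f': "smooth_term f'" "\<And>t. (f has_real_derivative f' t) (at t)"
    using smooth_term_derivative by blast
  then have "deriv f = f'" by (auto intro: DERIV_imp_deriv)
  then show ?thesis using f' by simp
qed

lemma smooth_term_differentiable:
  "smooth_term f \<Longrightarrow> (deriv ^^ k) f field_differentiable at t"
proof -
  assume "smooth_term f"
  then have "smooth_term ((deriv ^^ k) f)" by (induction k) (auto intro: smooth_term_deriv)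
  then show ?thesis using smooth_term_derivative field_differentiable_def by blast
qed

lemma smooth_step_exists:
  "\<exists>S. smooth_term S \<and> (\<forall>t\<le>0. S t = 0) \<and> (\<forall>t\<ge>1. S t = 1) \<and> (\<forall>t. 0 \<le> S t \<and> S t \<le> 1)"
proof -
  \<comment> \<open>the two summands never vanish together, so the quotient below has no pole\<close>
  define D where "D = (\<lambda>t. flat_exp 0 t + flat_exp 0 ((-1) * t + 1))"
  have pos: "D t > 0" for t
    by (cases "t > 0") (auto simp: D_def flat_exp_def add_pos_nonneg)
  then have ne: "D t \<noteq> 0" for t by (metis less_irrefl)
  have "smooth_term (\<lambda>t. flat_exp 0 t * inverse (D t))"
    unfolding D_def by (intro smooth_term.intros) (use ne in \<open>simp add: D_def\<close>)
  moreover have "0 \<le> flat_exp 0 t * inverse (D t) \<and> flat_exp 0 t * inverse (D t) \<le> 1" for t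
    using pos[of t] by (auto simp: D_def flat_exp_def field_simps)
  moreover have "flat_exp 0 t * inverse (D t) = 1" if "t \<ge> 1" for t
    using that by (simp add: D_def flat_exp_def)
  moreover have "flat_exp 0 t * inverse (D t) = 0" if "t \<le> 0" for t
    using that by (simp add: flat_exp_def)
  ultimately show ?thesis by (intro exI[of _ "\<lambda>t. flat_exp 0 t * inverse (D t)"]) auto
qed

lemma smooth_step_with_derivative:
  obtains S S' :: "real \<Rightarrow> real" and D where "smooth_term S" "\<And>t. (S has_real_derivative S' t) (at t)"
    "\<And>t. t \<le> 0 \<Longrightarrow> S t = 0" "\<And>t. t \<ge> 1 \<Longrightarrow> S t = 1" "\<And>t. 0 \<le> S t \<and> S t \<le> 1"
    "continuous_on UNIV S'" "\<And>t. t \<notin> {0..1} \<Longrightarrow> S' t = 0" "\<And>t. \<bar>S' t\<bar> \<le> D"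
proof -
  obtain S where S: "smooth_term S" "\<And>t. t \<le> 0 \<Longrightarrow> S t = 0" "\<And>t. t \<ge> 1 \<Longrightarrow> S t = 1" "\<And>t. 0 \<le> S t \<and> S t \<le> 1"
    using smooth_step_exists by blast
  obtain S' where S': "smooth_term S'" "\<And>t. (S has_real_derivative S' t) (at t)"
    using smooth_term_derivative[OF S(1)] by blast
  obtain S'' where "\<And>t. (S' has_real_derivative S'' t) (at t)"
    using smooth_term_derivative[OF S'(1)] by blast
  then have cont: "continuous_on UNIV S'" by (auto intro!: continuous_at_imp_continuous_on DERIV_isCont)
  have zero: "S' t = 0" if "t \<notin> {0..1}" for t
  proof -
    have "(S has_real_derivative 0) (at t)"
    proof (cases "t < 0")
      case True
      have "((\<lambda>_. 0) has_real_derivative 0) (at t)" by simp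
      then show ?thesis by (rule has_field_derivative_transform_within_open[of _ _ _ "{..<0}"]) (use True S in auto)
    next
      case False
      have "((\<lambda>_. 1) has_real_derivative 0) (at t)" by simp
      then show ?thesis by (rule has_field_derivative_transform_within_open[of _ _ _ "{1<..}"]) (use False that S in auto)
    qed
    then show ?thesis using S'(2) DERIV_unique by blast
  qed
  have "bounded (S' ` {0..1})"
    by (intro compact_imp_bounded compact_continuous_image continuous_on_subset[OF cont]) auto
  then have "\<exists>D. \<forall>t\<in>{0..1}. \<bar>S' t\<bar> \<le> D" by (auto simp: bounded_iff)
  then obtain D where "\<And>t. t \<in> {0..1} \<Longrightarrow> \<bar>S' t\<bar> \<le> D" by blast
  then have "\<bar>S' t\<bar> \<le> max D 0" for t using zero[of t] by (cases "t \<in> {0..1}") (force simp: max_def)+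
  then show thesis using that S S' cont zero by blast
qed

section \<open>Bounded weak derivatives\<close>

lemma integrable_lebesgue_on_superset:
  fixes f :: "real \<Rightarrow> 'a::euclidean_space"
  assumes "integrable (lebesgue_on A) f" "A \<subseteq> B" "A \<in> sets lebesgue" "B \<in> sets lebesgue"
    and "\<And>x. x \<notin> A \<Longrightarrow> f x = 0"
  shows "integrable (lebesgue_on B) f"
proof -
  have "(\<lambda>x. indicat_real A x *\<^sub>R f x) = (\<lambda>x. indicat_real B x *\<^sub>R f x)"
    using assms(2,5) by (auto simp: fun_eq_iff indicator_def)
  then show ?thesis using assms(1,3,4) by (simp add: integrable_restrict_space)
qed

text \<open>The kernel \<open>S' ((\<tau> - s) / h) / h\<close> has total mass one and lives on the window of length \<open>h\<close> to the right
of \<open>s\<close>, so integrating \<open>f\<close> against it reproduces \<open>f s\<close> up to the oscillation of \<open>f\<close> on that window.\<close>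

lemma mollifier_average:
  fixes f :: "real \<Rightarrow> complex" and S S' :: "real \<Rightarrow> real"
  assumes S: "\<And>t. (S has_real_derivative S' t) (at t)" "S 0 = 0" "S 1 = 1"
    and S': "continuous_on UNIV S'" "\<And>t. t \<notin> {0..1} \<Longrightarrow> S' t = 0" "\<And>t. \<bar>S' t\<bar> \<le> D"
    and h: "h > 0" and sub: "{s..s + h} \<subseteq> {u<..<v}" and f: "continuous_on {u<..<v} f"
    and close: "\<And>\<tau>. \<tau> \<in> {s..s + h} \<Longrightarrow> norm (f \<tau> - f s) \<le> e"
  shows "integrable (lebesgue_on {u<..<v}) (\<lambda>\<tau>. (S' ((\<tau> - s) / h) / h) *\<^sub>R f \<tau>)" (is "integrable _ ?F")
    and "norm ((LINT \<tau>|lebesgue_on {u<..<v}. (S' ((\<tau> - s) / h) / h) *\<^sub>R f \<tau>) - f s) \<le> D * e"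
proof -
  have zero: "?F \<tau> = 0" if "\<tau> \<notin> {s..s + h}" for \<tau>
    using that h S'(2)[of "(\<tau> - s) / h"] by (auto simp: field_simps)
  have "continuous_on {s..s + h} (\<lambda>\<tau>. S' ((\<tau> - s) / h))"
    by (rule continuous_on_compose2[OF S'(1)]) (use h in \<open>auto intro!: continuous_intros\<close>)
  then have cont: "continuous_on {s..s + h} ?F"
    using h continuous_on_subset[OF f sub] by (intro continuous_intros) auto
  then have "integrable (lebesgue_on {s..s + h}) ?F" by (rule continuous_imp_integrable_real)
  then show int: "integrable (lebesgue_on {u<..<v}) ?F"
    by (rule integrable_lebesgue_on_superset[OF _ sub _ _ zero]) auto
  have "(?F has_integral (LINT \<tau>|lebesgue_on {u<..<v}. ?F \<tau>)) {u<..<v}"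
    by (rule has_integral_integral_lebesgue_on[OF int]) auto
  moreover have "(?F has_integral integral {s..s + h} ?F) {u<..<v}"
    using integrable_integral[OF integrable_continuous_real[OF cont]] zero sub
    by (rule has_integral_on_superset)
  ultimately have LI: "(LINT \<tau>|lebesgue_on {u<..<v}. ?F \<tau>) = integral {s..s + h} ?F"
    by (rule has_integral_unique)
  have F: "(?F has_integral (LINT \<tau>|lebesgue_on {u<..<v}. ?F \<tau>)) {s..s + h}"
    unfolding LI by (rule integrable_integral[OF integrable_continuous_real[OF cont]])
  have "((\<lambda>\<tau>. S' ((\<tau> - s) / h) / h) has_integral (S ((s + h - s) / h) - S ((s - s) / h))) {s..s + h}"
  proof (rule fundamental_theorem_of_calculus)
    fix \<tau>
    have "((\<lambda>\<tau>. S ((\<tau> - s) / h)) has_real_derivative S' ((\<tau> - s) / h) * (1 / h)) (at \<tau> within {s..s + h})"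
      by (rule DERIV_chain2[OF S(1)]) (use h in \<open>auto intro!: derivative_eq_intros\<close>)
    then show "((\<lambda>\<tau>. S ((\<tau> - s) / h)) has_vector_derivative S' ((\<tau> - s) / h) / h) (at \<tau> within {s..s + h})"
      by (simp add: has_real_derivative_iff_has_vector_derivative)
  qed (use h in simp)
  then have "((\<lambda>\<tau>. S' ((\<tau> - s) / h) / h) has_integral 1) {s..s + h}" using h S by simp
  then have "((\<lambda>\<tau>. (S' ((\<tau> - s) / h) / h) *\<^sub>R f s) has_integral 1 *\<^sub>R f s) {s..s + h}"
    by (rule has_integral_scaleR_left)
  from has_integral_diff[OF F this]
  have G: "((\<lambda>\<tau>. (S' ((\<tau> - s) / h) / h) *\<^sub>R (f \<tau> - f s)) has_integral
      ((LINT \<tau>|lebesgue_on {u<..<v}. ?F \<tau>) - f s)) {s..s + h}"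
    by (simp add: algebra_simps)
  have D: "D \<ge> 0" using S'(3)[of 0] by linarith
  have e: "e \<ge> 0" using close[of s] h by auto
  have "norm ((LINT \<tau>|lebesgue_on {u<..<v}. ?F \<tau>) - f s) \<le> (D / h * e) * Henstock_Kurzweil_Integration.content {s..s + h}"
  proof (rule has_integral_bound_real[OF _ finite.emptyI G])
    fix \<tau> assume "\<tau> \<in> {s..s + h} - {}"
    then have "norm ((S' ((\<tau> - s) / h) / h) *\<^sub>R (f \<tau> - f s)) = \<bar>S' ((\<tau> - s) / h)\<bar> / h * norm (f \<tau> - f s)"
      using h by simp
    also have "\<dots> \<le> D / h * e"
      using S'(3) close \<open>\<tau> \<in> _\<close> h D by (intro mult_mono divide_right_mono) auto
    finally show "norm ((S' ((\<tau> - s) / h) / h) *\<^sub>R (f \<tau> - f s)) \<le> D / h * e" .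
  qed (use D e h in simp)
  then show "norm ((LINT \<tau>|lebesgue_on {u<..<v}. ?F \<tau>) - f s) \<le> D * e" using h by simp
qed

text \<open>Testing against an approximate indicator of the interval from \<open>s\<close> to \<open>t\<close> gives
\<open>f s - f t\<close> in the limit on one side, and on the other side minus the integral of \<open>g\<close> over that interval.\<close>

lemma weak_deriv_bounded_imp_lipschitz:
  assumes f: "continuous_on {u<..<v} f" and weak: "weak_deriv 1 u v f g"
    and C: "C \<ge> 0" "AE t in lebesgue_on {u<..<v}. norm (g t) \<le> C"
  shows "C-lipschitz_on {u<..<v} f"
proof (rule lipschitz_on_leI)
  fix s t assume s: "s \<in> {u<..<v}" and t: "t \<in> {u<..<v}" and "s \<le> t"
  obtain S S' :: "real \<Rightarrow> real" and D where S: "smooth_term S" "\<And>t. (S has_real_derivative S' t) (at t)"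
    "\<And>t. t \<le> 0 \<Longrightarrow> S t = 0" "\<And>t. t \<ge> 1 \<Longrightarrow> S t = 1" "\<And>t. 0 \<le> S t \<and> S t \<le> 1"
    and S': "continuous_on UNIV S'" "\<And>t. t \<notin> {0..1} \<Longrightarrow> S' t = 0" "\<And>t. \<bar>S' t\<bar> \<le> D"
    by (rule smooth_step_with_derivative) blast
  have D: "D \<ge> 0" using S'(3)[of 0] by linarith
  show "dist (f s) (f t) \<le> C * dist s t"
  proof (rule field_le_epsilon)
    fix \<epsilon> :: real assume "\<epsilon> > 0"
    define e where "e = \<epsilon> / (2 * D + C + 1)"
    have e: "e > 0" "(2 * D + C) * e \<le> \<epsilon>" using \<open>\<epsilon> > 0\<close> C D by (auto simp: e_def field_simps)
    have nb: "\<exists>h0>0. \<forall>\<tau>\<in>{x..x + h0}. \<tau> \<in> {u<..<v} \<and> norm (f \<tau> - f x) \<le> e" if x: "x \<in> {u<..<v}" for x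
    proof -
      have "isCont f x" using f x by (simp add: continuous_on_eq_continuous_at)
      then obtain d where d: "d > 0" "\<And>\<tau>. dist \<tau> x < d \<Longrightarrow> dist (f \<tau>) (f x) < e"
        using e(1) unfolding continuous_at_eps_delta by blast
      show ?thesis
      proof (intro exI[of _ "min (d / 2) ((v - x) / 2)"] conjI ballI)
        fix \<tau> assume "\<tau> \<in> {x..x + min (d / 2) ((v - x) / 2)}"
        then have \<tau>: "x \<le> \<tau>" "\<tau> \<le> x + d / 2" "\<tau> \<le> x + (v - x) / 2" by auto
        have "(v - x) / 2 < v - x" using x by simp
        then show "\<tau> \<in> {u<..<v}" using \<tau>(1,3) x unfolding greaterThanLessThan_iff by linarith
        show "norm (f \<tau> - f x) \<le> e" using d(2)[of \<tau>] \<tau> d(1) by (force simp: dist_norm)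
      qed (use d x in auto)
    qed
    obtain h1 where h1: "h1 > 0" "\<And>\<tau>. \<tau> \<in> {s..s + h1} \<Longrightarrow> \<tau> \<in> {u<..<v} \<and> norm (f \<tau> - f s) \<le> e" using nb[OF s] by blast
    obtain h2 where h2: "h2 > 0" "\<And>\<tau>. \<tau> \<in> {t..t + h2} \<Longrightarrow> \<tau> \<in> {u<..<v} \<and> norm (f \<tau> - f t) \<le> e" using nb[OF t] by blast
    define h where "h = min (min h1 h2) e"
    have h: "h > 0" "h \<le> e" "h \<le> h1" "h \<le> h2" using h1 h2 e by (auto simp: h_def)
    \<comment> \<open>a smooth replacement of the indicator of the interval from \<open>s\<close> to \<open>t\<close>: it climbs just to
      the right of \<open>s\<close> and falls just to the right of \<open>t\<close>, each time over a length \<open>h\<close>\<close>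
    define \<phi> where "\<phi> \<tau> = S (1 / h * \<tau> + (- s / h)) + (- 1) * S (1 / h * \<tau> + (- t / h))" for \<tau>
    have \<phi>_eq: "\<phi> \<tau> = S ((\<tau> - s) / h) - S ((\<tau> - t) / h)" for \<tau>
      by (simp add: \<phi>_def diff_divide_distrib)
    have "smooth_term \<phi>" unfolding \<phi>_def by (intro smooth_term.intros S(1))
    moreover have supp: "\<phi> \<tau> = 0" if "\<tau> \<notin> {s..t + h}" for \<tau>
    proof -
      have "\<tau> < s \<or> \<tau> > t + h" using that by auto
      then show ?thesis unfolding \<phi>_eq using h \<open>s \<le> t\<close> by (auto simp: S(3,4) field_simps)
    qed
    moreover have sub: "{s..t + h} \<subseteq> {u<..<v}" using s h2(2)[of "t + h"] h by auto
    ultimately have test: "test_function u v \<phi>"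
      unfolding test_function_def using smooth_term_differentiable
      by (intro conjI exI[of _ "{s..t + h}"]) auto
    have "deriv \<phi> \<tau> = S' ((\<tau> - s) / h) / h - S' ((\<tau> - t) / h) / h" for \<tau>
    proof (rule DERIV_imp_deriv)
      have "((\<lambda>\<tau>. S ((\<tau> - c) / h)) has_real_derivative S' ((\<tau> - c) / h) * (1 / h)) (at \<tau>)" for c
        by (rule DERIV_chain2[OF S(2)]) (use h in \<open>auto intro!: derivative_eq_intros\<close>)
      from DERIV_diff[OF this[of s] this[of t]]
      show "(\<phi> has_real_derivative S' ((\<tau> - s) / h) / h - S' ((\<tau> - t) / h) / h) (at \<tau>)"
        by (simp add: \<phi>_eq[abs_def])
    qed
    then have d\<phi>: "deriv \<phi> \<tau> *\<^sub>R f \<tau> = (S' ((\<tau> - s) / h) / h) *\<^sub>R f \<tau> - (S' ((\<tau> - t) / h) / h) *\<^sub>R f \<tau>" for \<tau>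
      by (simp add: scaleR_diff_left)
    let ?M = "lebesgue_on {u<..<v}"
    define I1 where "I1 = (LINT \<tau>|?M. (S' ((\<tau> - s) / h) / h) *\<^sub>R f \<tau>)"
    define I2 where "I2 = (LINT \<tau>|?M. (S' ((\<tau> - t) / h) / h) *\<^sub>R f \<tau>)"
    have subs: "{s..s + h} \<subseteq> {u<..<v}" "{t..t + h} \<subseteq> {u<..<v}" using h1(2) h2(2) h by (force)+
    note av1 = mollifier_average[OF S(2) S(3)[OF order_refl] S(4)[OF order_refl] S' h(1) subs(1) f, of e]
    note av2 = mollifier_average[OF S(2) S(3)[OF order_refl] S(4)[OF order_refl] S' h(1) subs(2) f, of e]
    have I1: "integrable ?M (\<lambda>\<tau>. (S' ((\<tau> - s) / h) / h) *\<^sub>R f \<tau>)" "norm (I1 - f s) \<le> D * e"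
      unfolding I1_def using h1(2) h by (intro av1; force)+
    have I2: "integrable ?M (\<lambda>\<tau>. (S' ((\<tau> - t) / h) / h) *\<^sub>R f \<tau>)" "norm (I2 - f t) \<le> D * e"
      unfolding I2_def using h2(2) h by (intro av2; force)+
    have "(LINT \<tau>|?M. deriv \<phi> \<tau> *\<^sub>R f \<tau>) = I1 - I2"
      unfolding d\<phi> I1_def I2_def by (rule Bochner_Integration.integral_diff[OF I1(1) I2(1)])
    moreover have "(LINT \<tau>|?M. deriv \<phi> \<tau> *\<^sub>R f \<tau>) = - (LINT \<tau>|?M. \<phi> \<tau> *\<^sub>R g \<tau>)"
      using weak test by (simp add: weak_deriv_def)
    ultimately have eq: "norm (I1 - I2) = norm (LINT \<tau>|?M. \<phi> \<tau> *\<^sub>R g \<tau>)" by (metis norm_minus_cancel)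
    have "norm (LINT \<tau>|?M. \<phi> \<tau> *\<^sub>R g \<tau>) \<le> C * (t + h - s)"
    proof (cases "integrable ?M (\<lambda>\<tau>. \<phi> \<tau> *\<^sub>R g \<tau>)")
      case True
      have "norm (LINT \<tau>|?M. \<phi> \<tau> *\<^sub>R g \<tau>) \<le> (LINT \<tau>|?M. norm (\<phi> \<tau> *\<^sub>R g \<tau>))" by (rule integral_norm_bound)
      also have "\<dots> \<le> (LINT \<tau>|?M. C * indicat_real {s..t + h} \<tau>)"
      proof (rule integral_mono_AE)
        show "integrable ?M (\<lambda>\<tau>. norm (\<phi> \<tau> *\<^sub>R g \<tau>))" using True by (rule integrable_norm)
        show "integrable ?M (\<lambda>\<tau>. C * indicat_real {s..t + h} \<tau>)"
          using sub by (intro integrable_mult_right) (simp add: integrable_restrict_space Int_absorb1 flip: indicator_inter_arith, auto intro!: integrable_real_indicator simp: emeasure_lborel_Icc_eq)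
        show "AE \<tau> in ?M. norm (\<phi> \<tau> *\<^sub>R g \<tau>) \<le> C * indicat_real {s..t + h} \<tau>"
          using C(2)
        proof eventually_elim
          case (elim \<tau>)
          have "\<bar>\<phi> \<tau>\<bar> \<le> indicat_real {s..t + h} \<tau>"
            using supp[of \<tau>] S(5)[of "(\<tau> - s) / h"] S(5)[of "(\<tau> - t) / h"] by (auto simp: \<phi>_eq indicator_def)
          then have "\<bar>\<phi> \<tau>\<bar> * norm (g \<tau>) \<le> indicat_real {s..t + h} \<tau> * C"
            using elim by (intro mult_mono) auto
          then show ?case by (simp add: mult.commute)
        qed
      qed
      also have "\<dots> = C * (t + h - s)"
        using sub h \<open>s \<le> t\<close> by (simp add: Int_absorb2 measure_restrict_space)
      finally show ?thesis .
    next
      case False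
      then show ?thesis using C h \<open>s \<le> t\<close> by (simp add: not_integrable_integral_eq)
    qed
    then have J: "norm (I1 - I2) \<le> C * (t - s) + C * e" using eq h(2) mult_left_mono[OF h(2) C(1)] by (simp add: algebra_simps)
    have "norm (f s - f t) \<le> norm (I1 - f s) + norm (I1 - I2) + norm (I2 - f t)"
    proof -
      have "f s - f t = (I1 - I2) - (I1 - f s) + (I2 - f t)" by simp
      then show ?thesis by (smt (verit) norm_triangle_ineq norm_triangle_ineq4)
    qed
    also have "\<dots> \<le> C * (t - s) + (2 * D + C) * e" using I1(2) I2(2) J by (simp add: algebra_simps)
    finally show "dist (f s) (f t) \<le> C * dist s t + \<epsilon>" using e(2) \<open>s \<le> t\<close> by (simp add: dist_norm)
  qed
qed (rule C(1))

section \<open>Lipschitz functions\<close>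

lemma lipschitz_on_compact_bounded:
  fixes f :: "real \<Rightarrow> 'a::real_normed_vector"
  assumes "L-lipschitz_on {s..t} f"
  shows "\<exists>C\<ge>0. \<forall>x\<in>{s..t}. norm (f x) \<le> C"
proof -
  have "compact (f ` {s..t})"
    using assms by (intro compact_continuous_image lipschitz_on_continuous_on[of L]) auto
  then have "bounded (f ` {s..t})" by (rule compact_imp_bounded)
  then obtain C where "\<forall>y\<in>f ` {s..t}. norm y \<le> C" by (auto simp: bounded_iff)
  then show ?thesis by (intro exI[of _ "max C 0"]) auto
qed

lemma lipschitz_on_bilinear:
  fixes f :: "real \<Rightarrow> 'a::real_normed_vector" and g :: "real \<Rightarrow> 'b::real_normed_vector"
  assumes h: "bounded_bilinear h" and f: "L-lipschitz_on {s..t} f" and g: "M-lipschitz_on {s..t} g"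
  shows "\<exists>C. C-lipschitz_on {s..t} (\<lambda>x. h (f x) (g x))"
proof -
  obtain F where F: "F \<ge> 0" "\<And>x. x \<in> {s..t} \<Longrightarrow> norm (f x) \<le> F" using lipschitz_on_compact_bounded[OF f] by blast
  obtain G where G: "G \<ge> 0" "\<And>x. x \<in> {s..t} \<Longrightarrow> norm (g x) \<le> G" using lipschitz_on_compact_bounded[OF g] by blast
  obtain K where K: "K \<ge> 0" "\<And>a b. norm (h a b) \<le> norm a * norm b * K"
    using bounded_bilinear.nonneg_bounded[OF h] by blast
  have LM: "L \<ge> 0" "M \<ge> 0" using f g by (auto dest: lipschitz_on_nonneg)
  have "(L * G * K + F * M * K)-lipschitz_on {s..t} (\<lambda>x. h (f x) (g x))"
  proof (rule lipschitz_onI)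
    fix x y assume xy: "x \<in> {s..t}" "y \<in> {s..t}"
    have "h (f x) (g x) - h (f y) (g y) = h (f x - f y) (g x) + h (f y) (g x - g y)"
      by (simp add: bounded_bilinear.diff_left[OF h] bounded_bilinear.diff_right[OF h])
    then have "norm (h (f x) (g x) - h (f y) (g y)) \<le> norm (h (f x - f y) (g x)) + norm (h (f y) (g x - g y))"
      by (simp add: norm_triangle_ineq)
    also have "\<dots> \<le> (L * norm (x - y)) * G * K + F * (M * norm (x - y)) * K"
      using lipschitz_on_normD[OF f xy] lipschitz_on_normD[OF g xy] F G K LM xy
      by (intro add_mono order_trans[OF K(2)] mult_right_mono mult_mono) auto
    finally show "dist (h (f x) (g x)) (h (f y) (g y)) \<le> (L * G * K + F * M * K) * dist x y"
      by (simp add: dist_norm algebra_simps)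
  qed (use F G K LM in auto)
  then show ?thesis by blast
qed

lemma lipschitz_on_inverse:
  fixes f :: "real \<Rightarrow> complex"
  assumes f: "L-lipschitz_on X f" and c: "c > 0" "\<And>x. x \<in> X \<Longrightarrow> c \<le> norm (f x)"
  shows "(L / c\<^sup>2)-lipschitz_on X (\<lambda>x. inverse (f x))"
proof (rule lipschitz_onI)
  fix x y assume xy: "x \<in> X" "y \<in> X"
  have L: "L \<ge> 0" using f by (rule lipschitz_on_nonneg)
  have nz: "f x \<noteq> 0" "f y \<noteq> 0" using c xy by force+
  have "inverse (f x) - inverse (f y) = (f y - f x) / (f x * f y)" using nz by (simp add: field_simps)
  then have "norm (inverse (f x) - inverse (f y)) = norm (f x - f y) / (norm (f x) * norm (f y))"
    by (simp add: norm_mult norm_divide norm_minus_commute)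
  also have "\<dots> \<le> (L * norm (x - y)) / (c * c)"
    using lipschitz_on_normD[OF f xy] c xy L by (intro frac_le mult_mono) auto
  finally show "dist (inverse (f x)) (inverse (f y)) \<le> L / c\<^sup>2 * dist x y"
    by (simp add: dist_norm power2_eq_square)
qed (use f c in \<open>auto dest: lipschitz_on_nonneg\<close>)

lemma lipschitz_extend_real:
  fixes f :: "real \<Rightarrow> 'a::complete_space"
  assumes f: "L-lipschitz_on {u<..<v} f" and uv: "u < v"
  shows "\<exists>g. L-lipschitz_on UNIV g \<and> (\<forall>x\<in>{u<..<v}. g x = f x)"
proof -
  obtain g where g: "L-lipschitz_on {u..v} g" "\<And>x. x \<in> {u<..<v} \<Longrightarrow> g x = f x"
    using lipschitz_extend_closure[OF f] uv by auto
  define c where "c x = max u (min v x)" for x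
  have "1-lipschitz_on UNIV c" by (rule lipschitz_onI) (auto simp: c_def dist_norm)
  moreover have "L-lipschitz_on (range c) g"
    by (rule lipschitz_on_subset[OF g(1)]) (use uv in \<open>auto simp: c_def\<close>)
  ultimately have "L-lipschitz_on UNIV (\<lambda>x. g (c x))"
    using lipschitz_on_compose2[of 1 UNIV c L g] by simp
  moreover have "g (c x) = f x" if "x \<in> {u<..<v}" for x using g(2)[OF that] that by (simp add: c_def)
  ultimately show ?thesis by (intro exI[of _ "\<lambda>x. g (c x)"]) auto
qed

lemma norm_ge_on_closed_interval:
  fixes f :: "real \<Rightarrow> complex"
  assumes "L-lipschitz_on UNIV f" "u < v" "\<And>t. t \<in> {u<..<v} \<Longrightarrow> c \<le> norm (f t)" "t \<in> {u..v}"
  shows "c \<le> norm (f t)"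
proof (rule continuous_ge_on_closure[of "{u<..<v}" "\<lambda>t. norm (f t)"])
  show "continuous_on (closure {u<..<v}) (\<lambda>t. norm (f t))"
    using lipschitz_on_continuous_on[OF assms(1)] by (intro continuous_intros) (auto intro: continuous_on_subset)
qed (use assms in auto)

text \<open>The forward average over a window of length \<open>\<eta>\<close> is differentiable everywhere: its derivative is the
difference quotient of \<open>C\<close> with step \<open>\<eta>\<close>, which the Lipschitz constant bounds.\<close>

lemma lipschitz_smoothing:
  fixes C :: "real \<Rightarrow> complex"
  assumes C: "L-lipschitz_on UNIV C" and \<eta>: "\<eta> > 0"
  shows "\<exists>k k'. \<forall>t\<in>{u..v}. (k has_vector_derivative k' t) (at t) \<and> norm (k' t) \<le> L \<and> norm (k t - C t) \<le> L * \<eta>"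
proof -
  have L: "L \<ge> 0" using C by (rule lipschitz_on_nonneg)
  have cont: "continuous_on X C" for X
    using lipschitz_on_continuous_on[OF C] continuous_on_subset by blast
  define G where "G t = integral {u - 1..t} C" for t
  have G: "(G has_vector_derivative C t) (at t)" if "t > u - 1" for t
  proof -
    have "(G has_vector_derivative C t) (at t within {u - 1..t + 1})"
      unfolding G_def by (rule integral_has_vector_derivative[OF cont]) (use that in auto)
    moreover have "at t within {u - 1..t + 1} = at t"
      using that by (intro at_within_interior) auto
    ultimately show ?thesis by simp
  qed
  define k where "k t = (1 / \<eta>) *\<^sub>R (G (t + \<eta>) - G t)" for t
  define k' where "k' t = (1 / \<eta>) *\<^sub>R (C (t + \<eta>) - C t)" for t
  have "(k has_vector_derivative k' t) (at t) \<and> norm (k' t) \<le> L \<and> norm (k t - C t) \<le> L * \<eta>" if t: "t \<in> {u..v}" for t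
  proof (intro conjI)
    have "((\<lambda>t. G (t + \<eta>)) has_vector_derivative C (t + \<eta>)) (at t)"
    proof -
      have "((G \<circ> (\<lambda>t. t + \<eta>)) has_vector_derivative (1 *\<^sub>R C (t + \<eta>))) (at t)"
        by (rule vector_diff_chain_at) (use t \<eta> in \<open>auto intro!: derivative_eq_intros G\<close>)
      then show ?thesis by (simp add: o_def)
    qed
    then show "(k has_vector_derivative k' t) (at t)"
      unfolding k_def k'_def using t by (auto intro!: derivative_eq_intros G)
    show "norm (k' t) \<le> L"
      using lipschitz_on_normD[OF C, of "t + \<eta>" t] \<eta> by (simp add: k'_def pos_divide_le_eq)
    have "((\<lambda>\<tau>. C \<tau> - C t) has_integral ((G (t + \<eta>) - (t + \<eta>) *\<^sub>R C t) - (G t - t *\<^sub>R C t))) {t..t + \<eta>}"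
    proof (rule fundamental_theorem_of_calculus)
      fix \<tau> assume "\<tau> \<in> {t..t + \<eta>}"
      then show "((\<lambda>\<tau>. G \<tau> - \<tau> *\<^sub>R C t) has_vector_derivative C \<tau> - C t) (at \<tau> within {t..t + \<eta>})"
        using t by (auto intro!: derivative_eq_intros has_vector_derivative_at_within[OF G])
    qed (use \<eta> in simp)
    then have "((\<lambda>\<tau>. C \<tau> - C t) has_integral (\<eta> *\<^sub>R (k t - C t))) {t..t + \<eta>}"
      using \<eta> by (simp add: k_def algebra_simps)
    then have "norm (\<eta> *\<^sub>R (k t - C t)) \<le> (L * \<eta>) * Henstock_Kurzweil_Integration.content {t..t + \<eta>}"
    proof (rule has_integral_bound_real[rotated 2, where S = "{}"])
      fix \<tau> assume "\<tau> \<in> {t..t + \<eta>} - {}"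
      then show "norm (C \<tau> - C t) \<le> L * \<eta>"
        using lipschitz_on_normD[OF C, of \<tau> t] L by (auto intro!: order_trans[OF _ mult_left_mono[of "\<tau> - t" \<eta> L]])
    qed (use L \<eta> in auto)
    then show "norm (k t - C t) \<le> L * \<eta>" using \<eta> by simp
  qed
  then show ?thesis by blast
qed

section \<open>Cones around the growing solutions\<close>

text \<open>Here \<open>X\<close> and \<open>Y\<close> stand for the norms of the growing and the decaying component, and the left-hand side
is the upper bound for the derivative of the quadratic form in \<open>cone_contraction\<close>. The main terms
\<open>- 2 * \<rho> * Y ^ 2\<close> and \<open>- 2 * \<rho> * B * X ^ 2\<close> have the same sign and absorb all others.\<close>

lemma cone_inequality:
  fixes X Y :: real
  assumes X: "X \<ge> 0" and Y: "Y \<ge> 0" and D: "D \<ge> 0" and K: "K \<ge> 0"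
    and \<epsilon>: "\<epsilon> > 0" and B: "\<epsilon> \<le> B" "B \<le> \<epsilon> + D * l" and l: "l > 0"
    and \<rho>: "2 * \<rho> \<ge> 3 * K * (1 + \<epsilon> + D * l)" "2 * \<rho> * \<epsilon> \<ge> D + 3 * K * (1 + \<epsilon> + D * l)"
  shows "2 * (- \<rho> * Y\<^sup>2 + K * Y * (X + Y)) + D * X\<^sup>2 - 2 * B * (\<rho> * X\<^sup>2 - K * X * (X + Y)) \<le> 0"
proof -
  define H where "H = 1 + \<epsilon> + D * l"
  have H: "0 \<le> B" "1 \<le> H" "B \<le> H" "1 + B \<le> H" using assms by (auto simp: H_def)
  have \<rho>0: "\<rho> \<ge> 0" using \<rho>(1) K H(2) unfolding H_def[symmetric]
    by (smt (verit) mult_nonneg_nonneg)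
  have XY: "2 * (X * Y) \<le> X\<^sup>2 + Y\<^sup>2" using zero_le_power2[of "X - Y"] by (simp add: power2_diff)
  have "2 * (- \<rho> * Y\<^sup>2 + K * Y * (X + Y)) + D * X\<^sup>2 - 2 * B * (\<rho> * X\<^sup>2 - K * X * (X + Y))
      = K * (1 + B) * (2 * (X * Y)) + 2 * K * (Y\<^sup>2 + B * X\<^sup>2) - 2 * \<rho> * Y\<^sup>2 + D * X\<^sup>2 - (2 * \<rho> * B) * X\<^sup>2"
    by (simp add: algebra_simps power2_eq_square)
  also have "\<dots> \<le> K * H * (X\<^sup>2 + Y\<^sup>2) + 2 * K * (H * Y\<^sup>2 + H * X\<^sup>2) - 2 * \<rho> * Y\<^sup>2 + D * X\<^sup>2 - (2 * \<rho> * \<epsilon>) * X\<^sup>2"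
  proof -
    have a: "K * (1 + B) * (2 * (X * Y)) \<le> K * H * (X\<^sup>2 + Y\<^sup>2)"
      using K H XY X Y by (intro mult_mono) auto
    have b: "2 * K * (Y\<^sup>2 + B * X\<^sup>2) \<le> 2 * K * (H * Y\<^sup>2 + H * X\<^sup>2)"
      using K H by (intro mult_left_mono add_mono mult_right_mono) (auto intro: mult_right_mono[of 1 H, simplified])
    have c: "(2 * \<rho> * \<epsilon>) * X\<^sup>2 \<le> (2 * \<rho> * B) * X\<^sup>2"
      using \<rho>0 B by (intro mult_right_mono mult_left_mono) auto
    show ?thesis using a b c by linarith
  qed
  also have "\<dots> = (3 * K * H - 2 * \<rho>) * Y\<^sup>2 + (D + 3 * K * H - 2 * \<rho> * \<epsilon>) * X\<^sup>2"
    by (simp add: algebra_simps)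
  also have "\<dots> \<le> 0"
    using \<rho> unfolding H_def[symmetric] by (intro add_nonpos_nonpos mult_nonpos_nonneg) auto
  finally show ?thesis .
qed

text \<open>The decay of \<open>M\<close> and the growth of \<open>P\<close> both push \<open>norm M ^ 2 - B * norm P ^ 2\<close> downwards, at a rate
proportional to \<open>\<rho>\<close>. That leaves room to let the weight \<open>B\<close> decrease from a large to a small value over the
interval, at a cost that does not depend on \<open>\<rho>\<close>.\<close>

lemma cone_contraction:
  fixes P M :: "real \<Rightarrow> complex"
  assumes uv: "u < v" and A: "A \<ge> 0" and \<epsilon>: "\<epsilon> > 0" and K: "K \<ge> 0"
    and \<rho>: "2 * \<rho> \<ge> 3 * K * (1 + \<epsilon>\<^sup>2 + A\<^sup>2)" "2 * \<rho> * \<epsilon>\<^sup>2 \<ge> A\<^sup>2 / (v - u) + 3 * K * (1 + \<epsilon>\<^sup>2 + A\<^sup>2)"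
    and P: "LP-lipschitz_on {u..v} P" and M: "LM-lipschitz_on {u..v} M"
    and ae: "AE t in lebesgue_on {u..v}. \<exists>\<kappa> e e'. Re \<kappa> \<ge> \<rho> \<and>
        (P has_vector_derivative (\<kappa> * P t + e)) (at t) \<and>
        (M has_vector_derivative (- \<kappa> * M t + e')) (at t) \<and>
        norm e \<le> K * (norm (P t) + norm (M t)) \<and> norm e' \<le> K * (norm (P t) + norm (M t))"
    and start: "norm (M u) \<le> A * norm (P u)"
  shows "norm (M v) \<le> \<epsilon> * norm (P v)"
proof -
  \<comment> \<open>\<open>B\<close> falls linearly from \<open>\<epsilon>\<^sup>2 + A\<^sup>2\<close> at \<open>u\<close> to \<open>\<epsilon>\<^sup>2\<close> at \<open>v\<close>, so that \<open>\<Phi> \<le> 0\<close> is implied by the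
    hypothesis at \<open>u\<close> and is the conclusion at \<open>v\<close>\<close>
  define D where "D = A\<^sup>2 / (v - u)"
  have D: "D \<ge> 0" "D * (v - u) = A\<^sup>2" using uv by (auto simp: D_def)
  define B where "B t = \<epsilon>\<^sup>2 + D * (v - t)" for t
  define \<Phi> where "\<Phi> t = M t \<bullet> M t - B t * (P t \<bullet> P t)" for t
  have \<Phi>lip: "\<exists>C. C-lipschitz_on {u..v} \<Phi>"
  proof -
    obtain C1 where C1: "C1-lipschitz_on {u..v} (\<lambda>t. M t \<bullet> M t)"
      using lipschitz_on_bilinear[OF bounded_bilinear_inner M M] by blast
    obtain C2 where C2: "C2-lipschitz_on {u..v} (\<lambda>t. P t \<bullet> P t)"
      using lipschitz_on_bilinear[OF bounded_bilinear_inner P P] by blast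
    have "D-lipschitz_on {u..v} B"
    proof (rule lipschitz_onI)
      fix x y
      have "B x - B y = D * (y - x)" by (simp add: B_def algebra_simps)
      then show "dist (B x) (B y) \<le> D * dist x y" using D by (simp add: dist_norm abs_mult abs_minus_commute)
    qed (use D in simp)
    then obtain C3 where C3: "C3-lipschitz_on {u..v} (\<lambda>t. B t * (P t \<bullet> P t))"
      using lipschitz_on_bilinear[OF bounded_bilinear_mult _ C2] by blast
    show ?thesis unfolding \<Phi>_def using lipschitz_on_diff[OF C1 C3] by blast
  qed
  have "\<Phi> v \<le> \<Phi> u"
  proof -
    have "AE t in lebesgue_on {u..v}. t \<in> {u..v}" by (simp add: AE_restrict_space_iff)
    with ae have "AE t in lebesgue_on {u..v}. \<exists>d. (\<Phi> has_real_derivative d) (at t) \<and> d \<le> 0"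
    proof eventually_elim
      case (elim t)
      then obtain \<kappa> e e' where \<kappa>: "Re \<kappa> \<ge> \<rho>"
        and Pd: "(P has_vector_derivative (\<kappa> * P t + e)) (at t)"
        and Md: "(M has_vector_derivative (- \<kappa> * M t + e')) (at t)"
        and e: "norm e \<le> K * (norm (P t) + norm (M t))" "norm e' \<le> K * (norm (P t) + norm (M t))" by blast
      define d where "d = 2 * (M t \<bullet> (- \<kappa> * M t + e')) + D * (P t \<bullet> P t) - 2 * B t * (P t \<bullet> (\<kappa> * P t + e))"
      have PP: "((\<lambda>t. P t \<bullet> P t) has_real_derivative 2 * (P t \<bullet> (\<kappa> * P t + e))) (at t)"
        using bounded_bilinear.has_vector_derivative[OF bounded_bilinear_inner Pd Pd]
        by (simp add: has_real_derivative_iff_has_vector_derivative inner_commute)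
      have MM: "((\<lambda>t. M t \<bullet> M t) has_real_derivative 2 * (M t \<bullet> (- \<kappa> * M t + e'))) (at t)"
        using bounded_bilinear.has_vector_derivative[OF bounded_bilinear_inner Md Md]
        by (simp add: has_real_derivative_iff_has_vector_derivative inner_commute)
      have Bd: "(B has_real_derivative - D) (at t)" unfolding B_def by (auto intro!: derivative_eq_intros)
      have "(\<Phi> has_real_derivative d) (at t)"
        unfolding \<Phi>_def
        by (rule DERIV_cong[OF DERIV_diff[OF MM DERIV_mult[OF Bd PP]]]) (simp add: d_def algebra_simps)
      moreover have "d \<le> 0"
      proof -
        let ?X = "norm (P t)" and ?Y = "norm (M t)"
        have \<kappa>in: "z \<bullet> (\<kappa> * z) = Re \<kappa> * (norm z)\<^sup>2" for z
          by (simp add: inner_complex_def cmod_def power2_eq_square algebra_simps)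
        have m1: "M t \<bullet> (- \<kappa> * M t + e') \<le> - \<rho> * ?Y\<^sup>2 + K * ?Y * (?X + ?Y)"
        proof -
          have "M t \<bullet> e' \<le> ?Y * (K * (?X + ?Y))"
            by (rule order_trans[OF norm_cauchy_schwarz]) (use e in \<open>auto intro: mult_left_mono\<close>)
          moreover have "\<rho> * ?Y\<^sup>2 \<le> Re \<kappa> * ?Y\<^sup>2" using \<kappa> by (intro mult_right_mono) auto
          ultimately show ?thesis using \<kappa>in[of "M t"] by (simp add: inner_add_right algebra_simps)
        qed
        have m2: "P t \<bullet> (\<kappa> * P t + e) \<ge> \<rho> * ?X\<^sup>2 - K * ?X * (?X + ?Y)"
        proof -
          have "P t \<bullet> (- e) \<le> ?X * (K * (?X + ?Y))"
            by (rule order_trans[OF norm_cauchy_schwarz]) (use e in \<open>auto intro: mult_left_mono\<close>)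
          moreover have "\<rho> * ?X\<^sup>2 \<le> Re \<kappa> * ?X\<^sup>2" using \<kappa> by (intro mult_right_mono) auto
          ultimately show ?thesis using \<kappa>in[of "P t"] by (simp add: inner_add_right algebra_simps)
        qed
        have Bt: "\<epsilon>\<^sup>2 \<le> B t" "B t \<le> \<epsilon>\<^sup>2 + D * (v - u)"
          using elim(2) D(1) uv unfolding B_def by (auto intro!: mult_left_mono mult_nonneg_nonneg)
        have "B t \<ge> 0" using Bt(1) by (rule order_trans[OF zero_le_power2])
        then have "d \<le> 2 * (- \<rho> * ?Y\<^sup>2 + K * ?Y * (?X + ?Y)) + D * ?X\<^sup>2 - 2 * B t * (\<rho> * ?X\<^sup>2 - K * ?X * (?X + ?Y))"
          unfolding d_def using m1 mult_left_mono[OF m2, of "2 * B t"] by (simp add: power2_norm_eq_inner)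
        also have "\<dots> \<le> 0"
          by (rule cone_inequality[where \<epsilon> = "\<epsilon>\<^sup>2" and l = "v - u"])
             (use D K \<epsilon> Bt uv \<rho> in \<open>simp_all add: D_def\<close>)
        finally show ?thesis .
      qed
      ultimately show ?case by blast
    qed
    then show ?thesis using \<Phi>lip uv lipschitz_on_decreasing[of _ u v \<Phi>] by fastforce
  qed
  also have "\<Phi> u \<le> 0"
  proof -
    have "(norm (M u))\<^sup>2 \<le> (A * norm (P u))\<^sup>2" using start by (intro power_mono) auto
    also have "\<dots> \<le> B u * (norm (P u))\<^sup>2"
      unfolding power_mult_distrib using D by (intro mult_right_mono) (auto simp: B_def)
    finally show ?thesis by (simp add: \<Phi>_def power2_norm_eq_inner)
  qed
  finally have "(norm (M v))\<^sup>2 \<le> (\<epsilon> * norm (P v))\<^sup>2"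
    by (simp add: \<Phi>_def B_def power2_norm_eq_inner power_mult_distrib)
  then show ?thesis using \<epsilon> by (meson mult_nonneg_nonneg norm_ge_zero power2_le_imp_le less_imp_le)
qed

text \<open>With \<open>z = U / \<kappa>\<close> the two norms are those of the decaying and of the growing component relative to the
coefficient \<open>c\<close>. The quantity \<open>z\<close> is continuous across interfaces, whereas the components
are not.\<close>

definition in_cone :: "real \<Rightarrow> complex \<Rightarrow> complex \<Rightarrow> complex \<Rightarrow> bool" where
  "in_cone \<alpha> c y z \<longleftrightarrow> norm (y - z / c) \<le> \<alpha> * norm (y + z / c)"

text \<open>Passing from \<open>c\<close> to \<open>c'\<close> transforms the components by
\<open>P' = ((1 + s) * P + (1 - s) * M) / 2\<close> and \<open>M' = ((1 - s) * P + (1 + s) * M) / 2\<close>. The inequality for \<open>\<alpha>\<close> and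
\<open>\<beta>\<close> is what the triangle inequality then requires.\<close>

lemma in_cone_change:
  assumes c: "c \<noteq> 0" "c' \<noteq> 0" and \<beta>: "\<beta> \<ge> 0" and s: "s = c / c'"
    and ineq: "norm (1 - s) + \<alpha> * norm (1 + s) \<le> \<beta> * (norm (1 + s) - \<alpha> * norm (1 - s))"
    and cone: "in_cone \<alpha> c y z"
  shows "in_cone \<beta> c' y z"
proof -
  define P M where "P = y + z / c" and "M = y - z / c"
  have z: "z / c' = s * (z / c)" using c s by simp
  have y: "y = (P + M) / 2" "z / c = (P - M) / 2" by (simp_all add: P_def M_def)
  have P': "y + z / c' = ((1 + s) * P + (1 - s) * M) / 2" unfolding z y by (simp add: field_simps)
  have M': "y - z / c' = ((1 - s) * P + (1 + s) * M) / 2" unfolding z y by (simp add: field_simps)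
  have PM: "norm M \<le> \<alpha> * norm P" using cone by (simp add: in_cone_def P_def M_def)
  have "2 * norm (y - z / c') \<le> norm (1 - s) * norm P + norm (1 + s) * norm M"
    unfolding M' using norm_triangle_ineq[of "(1 - s) * P" "(1 + s) * M"] by (simp add: norm_mult norm_divide)
  also have "\<dots> \<le> norm (1 - s) * norm P + norm (1 + s) * (\<alpha> * norm P)"
    using PM by (intro add_left_mono mult_left_mono) auto
  also have "\<dots> = (norm (1 - s) + \<alpha> * norm (1 + s)) * norm P" by (simp add: algebra_simps)
  also have "\<dots> \<le> \<beta> * (norm (1 + s) - \<alpha> * norm (1 - s)) * norm P"
    using ineq by (intro mult_right_mono) auto
  also have "\<dots> = \<beta> * (norm (1 + s) * norm P - norm (1 - s) * (\<alpha> * norm P))" by (simp add: algebra_simps)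
  also have "\<dots> \<le> \<beta> * (norm (1 + s) * norm P - norm (1 - s) * norm M)"
    using PM \<beta> by (intro mult_left_mono diff_left_mono) auto
  also have "\<dots> \<le> \<beta> * (2 * norm (y + z / c'))"
  proof (intro mult_left_mono \<beta>)
    show "norm (1 + s) * norm P - norm (1 - s) * norm M \<le> 2 * norm (y + z / c')"
      unfolding P' using norm_diff_ineq[of "(1 + s) * P" "(1 - s) * M"] by (simp add: norm_mult norm_divide)
  qed
  finally show ?thesis by (simp add: in_cone_def)
qed

lemma in_cone_perturb:
  assumes c: "c \<noteq> 0" "c' \<noteq> 0" and \<alpha>\<beta>: "0 \<le> \<alpha>" "\<alpha> < \<beta>"
    and close: "norm (c' - c) \<le> \<delta> * norm c'" and \<delta>: "\<delta> * ((1 + \<alpha>) * (1 + \<beta>)) \<le> 2 * (\<beta> - \<alpha>)"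
    and cone: "in_cone \<alpha> c y z"
  shows "in_cone \<beta> c' y z"
proof (rule in_cone_change[OF c _ refl _ cone])
  let ?s = "c / c'"
  have "1 - ?s = (c' - c) / c'" using c by (simp add: field_simps)
  then have "norm (1 - ?s) \<le> \<delta>" using close c by (simp add: norm_divide pos_divide_le_eq)
  then have "norm (1 - ?s) * ((1 + \<alpha>) * (1 + \<beta>)) \<le> \<delta> * ((1 + \<alpha>) * (1 + \<beta>))"
    using \<alpha>\<beta> by (intro mult_right_mono) auto
  then have a: "norm (1 - ?s) * ((1 + \<alpha>) * (1 + \<beta>)) \<le> 2 * (\<beta> - \<alpha>)" using \<delta> by linarith
  have "norm (1 + ?s) \<ge> 2 - norm (1 - ?s)"
    using norm_triangle_ineq[of "1 + ?s" "1 - ?s"] by simp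
  then have "(\<beta> - \<alpha>) * norm (1 + ?s) \<ge> (\<beta> - \<alpha>) * (2 - norm (1 - ?s))"
    using \<alpha>\<beta> by (intro mult_left_mono) auto
  moreover have "0 \<le> \<alpha> * norm (1 - ?s)" using \<alpha>\<beta> by simp
  ultimately show "norm (1 - ?s) + \<alpha> * norm (1 + ?s) \<le> \<beta> * (norm (1 + ?s) - \<alpha> * norm (1 - ?s))"
    using a by (simp add: algebra_simps)
qed (use \<alpha>\<beta> in simp)

text \<open>The growing component keeps a nonzero multiple \<open>(1 + c / c') / 2\<close> of itself, up to a small error if
the cone before the interface is narrow enough.\<close>

lemma in_cone_interface:
  assumes c: "c \<noteq> 0" "c' \<noteq> 0" "c' + c \<noteq> 0"
  shows "\<exists>\<alpha>>0. \<exists>\<beta>\<ge>0. \<forall>y z. in_cone \<alpha> c y z \<longrightarrow> in_cone \<beta> c' y z"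
proof -
  define a b where "a = norm (1 - c / c')" and "b = norm (1 + c / c')"
  have "1 + c / c' = (c' + c) / c'" using c by (simp add: field_simps)
  then have b: "b > 0" using c by (simp add: b_def)
  have a: "a \<ge> 0" by (simp add: a_def)
  \<comment> \<open>\<open>\<alpha>\<close> is so small that the new growing component keeps half of its leading part\<close>
  define \<alpha> where "\<alpha> = b / (2 * (1 + a))"
  define \<beta> where "\<beta> = (a + \<alpha> * b) * (2 / b)"
  have \<alpha>: "\<alpha> > 0" using a b by (simp add: \<alpha>_def)
  have \<beta>: "\<beta> \<ge> 0" using a b \<alpha> by (simp add: \<beta>_def)
  have "\<alpha> * a \<le> \<alpha> * (1 + a)" using \<alpha> by (intro mult_left_mono) auto
  also have "\<dots> = b / 2" using a by (simp add: \<alpha>_def field_simps)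
  finally have "b / 2 \<le> b - \<alpha> * a" by simp
  then have "\<beta> * (b / 2) \<le> \<beta> * (b - \<alpha> * a)" using \<beta> by (rule mult_left_mono)
  moreover have "\<beta> * (b / 2) = a + \<alpha> * b" using b by (simp add: \<beta>_def)
  ultimately have "a + \<alpha> * b \<le> \<beta> * (b - \<alpha> * a)" by simp
  then have "in_cone \<beta> c' y z" if "in_cone \<alpha> c y z" for y z
    using in_cone_change[OF c(1,2) \<beta> refl _ that] by (simp add: a_def b_def)
  then show ?thesis using \<alpha> \<beta> by blast
qed

lemma in_cone_start: "y = 0 \<or> z = 0 \<Longrightarrow> in_cone 1 c y z"
  by (auto simp: in_cone_def)

lemma in_cone_end:
  assumes "in_cone (1 / 2) c y z" "y = 0 \<or> z = 0" "c \<noteq> 0"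
  shows "y = 0 \<and> z = 0"
  using assms by (auto simp: in_cone_def)

section \<open>Contraction on one subinterval\<close>

text \<open>With \<open>V = U / (\<kappa> * k)\<close> for a smoothed coefficient \<open>k\<close>, the functions \<open>y + V\<close> and \<open>y - V\<close> satisfy the
hypotheses of \<open>cone_contraction\<close> with error constants that do not depend on \<open>\<kappa>\<close>, and with a growth
rate proportional to the modulus of \<open>\<kappa>\<close>. The factors \<open>of_real (r t) / C t\<close> and
\<open>of_real (r t) * C t\<close> are \<open>1 / p\<close> and \<open>w\<close>.\<close>

lemma segment_contraction:
  fixes C :: "real \<Rightarrow> complex" and r :: "real \<Rightarrow> real"
  assumes uv: "u < v" and A: "A \<ge> 0" and \<epsilon>: "\<epsilon> > 0"
    and C: "L-lipschitz_on UNIV C" and c0: "c0 > 0" "\<And>t. t \<in> {u..v} \<Longrightarrow> c0 \<le> norm (C t)"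
    and r0: "r0 > 0" and r: "\<And>t. t \<in> {u<..<v} \<Longrightarrow> r0 \<le> r t \<and> r t \<le> r1" and Q: "Q \<ge> 0"
  shows "\<exists>K0. \<forall>\<kappa> y U Ly LU. norm \<kappa> \<ge> K0 \<longrightarrow> 2 * Re \<kappa> \<ge> norm \<kappa> \<longrightarrow>
      Ly-lipschitz_on {u..v} y \<longrightarrow> LU-lipschitz_on {u..v} U \<longrightarrow>
      (AE t in lebesgue_on {u..v}. \<exists>q. norm q \<le> Q \<and>
         (y has_vector_derivative of_real (r t) * U t / C t) (at t) \<and>
         (U has_vector_derivative (q + \<kappa>\<^sup>2 * of_real (r t) * C t) * y t) (at t)) \<longrightarrow>
      in_cone A (C u) (y u) (U u / \<kappa>) \<longrightarrow> in_cone \<epsilon> (C v) (y v) (U v / \<kappa>)"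
proof -
  have L: "L \<ge> 0" using C by (rule lipschitz_on_nonneg)
  have r1: "r1 > 0" using r[of "(u + v) / 2"] r0 uv by auto
  define K where "K = (2 * r1 * L + 2 * Q + 2 * L) / c0"
  have K: "K \<ge> 0" using L Q r1 c0 by (simp add: K_def)
  define H where "H = 3 * K * (1 + (\<epsilon> / 2)\<^sup>2 + (A + 1)\<^sup>2)"
  have H: "H \<ge> 0" using K by (simp add: H_def)
  \<comment> \<open>lower bounds for \<open>norm \<kappa>\<close>: the first two make the growth rate large enough for the contraction,
    the third keeps the smoothed coefficient away from zero, and the last two make the passages
    between \<open>C\<close> and the smoothed coefficient at \<open>u\<close> and at \<open>v\<close> cheap\<close>
  define X1 where "X1 = H / r0"
  define X2 where "X2 = ((A + 1)\<^sup>2 / (v - u) + H) / (r0 * (\<epsilon> / 2)\<^sup>2)"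
  define X3 where "X3 = 2 * L / c0"
  define X4 where "X4 = (2 * L / c0) * ((1 + A) * (1 + (A + 1))) / 2"
  define X5 where "X5 = (2 * L / c0) * ((1 + \<epsilon> / 2) * (1 + \<epsilon>)) / \<epsilon>"
  have X: "X1 \<ge> 0" "X2 \<ge> 0" "X3 \<ge> 0" "X4 \<ge> 0" "X5 \<ge> 0"
    using H L A \<epsilon> r0 c0 uv by (auto simp: X1_def X2_def X3_def X4_def X5_def)
  show ?thesis
  proof (intro exI[of _ "1 + X1 + X2 + X3 + X4 + X5"] allI impI)
    fix \<kappa> y U Ly LU
    assume n0: "norm \<kappa> \<ge> 1 + X1 + X2 + X3 + X4 + X5" and Re\<kappa>: "2 * Re \<kappa> \<ge> norm \<kappa>"
      and y: "Ly-lipschitz_on {u..v} y" and U: "LU-lipschitz_on {u..v} U"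
      and ae: "AE t in lebesgue_on {u..v}. \<exists>q. norm q \<le> Q \<and>
         (y has_vector_derivative of_real (r t) * U t / C t) (at t) \<and>
         (U has_vector_derivative (q + \<kappa>\<^sup>2 * of_real (r t) * C t) * y t) (at t)"
      and start: "in_cone A (C u) (y u) (U u / \<kappa>)"
    define n where "n = norm \<kappa>"
    have n: "n \<ge> 1" "n \<ge> X1" "n \<ge> X2" "n \<ge> X3" "n \<ge> X4" "n \<ge> X5" using n0 X by (auto simp: n_def)
    have \<kappa>: "\<kappa> \<noteq> 0" using n(1) by (auto simp: n_def)
    \<comment> \<open>smoothing at scale \<open>1 / n\<close> changes the coefficient by \<open>O(1 / n)\<close>, which the factor \<open>\<kappa>\<close>
      in the equations turns into a bounded error\<close>
    have "1 / n > 0" using n(1) by simp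
    then obtain k k' where kk: "\<forall>t\<in>{u..v}. (k has_vector_derivative k' t) (at t) \<and>
        norm (k' t) \<le> L \<and> norm (k t - C t) \<le> L * (1 / n)"
      using lipschitz_smoothing[OF C, of "1 / n" u v] by blast
    then have k: "\<And>t. t \<in> {u..v} \<Longrightarrow> (k has_vector_derivative k' t) (at t)"
      "\<And>t. t \<in> {u..v} \<Longrightarrow> norm (k' t) \<le> L" "\<And>t. t \<in> {u..v} \<Longrightarrow> norm (k t - C t) \<le> L / n"
      by auto
    have Ln: "L / n \<le> c0 / 2" using n(1,4) c0(1) by (simp add: X3_def field_simps)
    have kc: "c0 / 2 \<le> norm (k t)" if "t \<in> {u..v}" for t
    proof -
      have "norm (C t - k t) \<le> L / n" using k(3)[OF that] by (simp add: norm_minus_commute)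
      then show ?thesis using c0(2)[OF that] Ln norm_triangle_ineq2[of "C t" "k t"] by linarith
    qed
    have k0: "k t \<noteq> 0" "C t \<noteq> 0" if "t \<in> {u..v}" for t
      using kc[OF that] c0(1) c0(2)[OF that] by auto
    define V where "V t = U t / (\<kappa> * k t)" for t
    have UV: "U t = \<kappa> * k t * V t" if "t \<in> {u..v}" for t
      using \<kappa> k0[OF that] by (simp add: V_def)
    have "L-lipschitz_on {u..v} k"
    proof (rule bounded_derivative_imp_lipschitz)
      fix t assume "t \<in> {u..v}"
      then show "(k has_derivative (\<lambda>h. h *\<^sub>R k' t)) (at t within {u..v})"
        using k(1) has_vector_derivative_at_within unfolding has_vector_derivative_def by blast
      show "onorm (\<lambda>h. h *\<^sub>R k' t) \<le> L"
        using k(2)[OF \<open>t \<in> _\<close>] by (intro onorm_bound) (auto simp: L mult.commute[of _ "norm (k' t)"] intro!: mult_right_mono)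
    qed (use L in auto)
    then have "(L / (c0 / 2)\<^sup>2)-lipschitz_on {u..v} (\<lambda>t. inverse (k t))"
      using c0(1) kc by (intro lipschitz_on_inverse) auto
    from lipschitz_on_bilinear[OF bounded_bilinear_mult U this]
    obtain L1 where "L1-lipschitz_on {u..v} (\<lambda>t. U t * inverse (k t))" by blast
    from lipschitz_on_bilinear[OF bounded_bilinear_mult this lipschitz_on_constant[of _ "inverse \<kappa>"]]
    obtain LV where "LV-lipschitz_on {u..v} (\<lambda>t. U t * inverse (k t) * inverse \<kappa>)" by blast
    moreover have "(\<lambda>t. U t * inverse (k t) * inverse \<kappa>) = V" by (auto simp: V_def fun_eq_iff divide_inverse)
    ultimately have V: "LV-lipschitz_on {u..v} V" by (simp only:)
    \<comment> \<open>replacing \<open>C\<close> by \<open>k\<close> costs some opening: \<open>A\<close> becomes \<open>A + 1\<close> here, and at the end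
      \<open>\<epsilon> / 2\<close> becomes \<open>\<epsilon>\<close>\<close>
    have "norm (y u - V u) \<le> (A + 1) * norm (y u + V u)"
    proof -
      have "in_cone (A + 1) (k u) (y u) (U u / \<kappa>)"
      proof (rule in_cone_perturb[OF _ _ A _ _ _ start])
        show "norm (k u - C u) \<le> (2 * L / c0 / n) * norm (k u)"
          using k(3)[of u] mult_left_mono[OF kc[of u], of "2 * L / c0 / n"] L c0(1) n(1) uv by simp
        show "(2 * L / c0 / n) * ((1 + A) * (1 + (A + 1))) \<le> 2 * (A + 1 - A)"
        proof -
          have "(2 * L / c0 / n) * ((1 + A) * (1 + (A + 1))) = 2 * (X4 / n)" by (simp add: X4_def)
          moreover have "X4 / n \<le> 1" using n(1,5) by simp
          ultimately show ?thesis by simp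
        qed
      qed (use k0 uv in auto)
      then show ?thesis by (simp add: in_cone_def V_def)
    qed
    moreover have "AE t in lebesgue_on {u..v}. \<exists>\<kappa>' e e'. Re \<kappa>' \<ge> n * r0 / 2 \<and>
        ((\<lambda>t. y t + V t) has_vector_derivative (\<kappa>' * (y t + V t) + e)) (at t) \<and>
        ((\<lambda>t. y t - V t) has_vector_derivative (- \<kappa>' * (y t - V t) + e')) (at t) \<and>
        norm e \<le> K * (norm (y t + V t) + norm (y t - V t)) \<and> norm e' \<le> K * (norm (y t + V t) + norm (y t - V t))"
    proof -
      have "AE t in lebesgue_on {u..v}. t \<notin> {u, v}" by (rule AE_lebesgue_on_not_in_finite) auto
      moreover have "AE t in lebesgue_on {u..v}. t \<in> {u..v}" by (simp add: AE_restrict_space_iff)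
      ultimately show ?thesis using ae
      proof eventually_elim
        case (elim t)
        then have t: "t \<in> {u<..<v}" "t \<in> {u..v}" by auto
        obtain q where q: "norm q \<le> Q"
          and yd: "(y has_vector_derivative of_real (r t) * U t / C t) (at t)"
          and Ud: "(U has_vector_derivative (q + \<kappa>\<^sup>2 * of_real (r t) * C t) * y t) (at t)"
          using elim by blast
        note kt = k0[OF t(2)]
        \<comment> \<open>\<open>a1\<close> and \<open>a2\<close> are the smoothing errors, \<open>a3\<close> comes from the potential and \<open>a4\<close> from
          differentiating the smoothed coefficient\<close>
        define a1 where "a1 = \<kappa> * of_real (r t) * ((k t - C t) / C t)"
        define a2 where "a2 = \<kappa> * of_real (r t) * ((C t - k t) / k t)"
        define a3 where "a3 = q / (\<kappa> * k t)"
        define a4 where "a4 = k' t / k t"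
        have rt: "0 \<le> r t" "r t \<le> r1" "r0 \<le> r t" using r[OF t(1)] r0 by auto
        have kC: "norm (k t - C t) \<le> L / n" "norm (C t - k t) \<le> L / n"
          using k(3)[OF t(2)] by (auto simp: norm_minus_commute)
        have a1: "norm a1 \<le> r1 * L / c0"
        proof -
          have "norm a1 = n * r t * (norm (k t - C t) / norm (C t))"
            using rt by (simp add: a1_def n_def norm_mult norm_divide)
          also have "\<dots> \<le> n * r1 * (L / n / c0)"
            using rt kC c0(1) c0(2)[OF t(2)] n(1) r1 L by (intro mult_mono frac_le) auto
          finally show ?thesis using n(1) by simp
        qed
        have a2: "norm a2 \<le> 2 * r1 * L / c0"
        proof -
          have "norm a2 = n * r t * (norm (C t - k t) / norm (k t))"
            using rt by (simp add: a2_def n_def norm_mult norm_divide)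
          also have "\<dots> \<le> n * r1 * (L / n / (c0 / 2))"
            using rt kC c0(1) kc[OF t(2)] n(1) r1 L by (intro mult_mono frac_le) auto
          finally show ?thesis using n(1) by (simp add: mult_ac)
        qed
        have a3: "norm a3 \<le> 2 * Q / c0"
        proof -
          have "norm a3 = norm q / (n * norm (k t))" by (simp add: a3_def n_def norm_mult norm_divide)
          also have "\<dots> \<le> Q / (1 * (c0 / 2))"
            using q Q n(1) c0(1) kc[OF t(2)] by (intro frac_le mult_mono) auto
          finally show ?thesis by (simp add: mult_ac)
        qed
        have a4: "norm a4 \<le> 2 * L / c0"
        proof -
          have "norm a4 \<le> L / (c0 / 2)"
            unfolding a4_def norm_divide using k(2)[OF t(2)] kc[OF t(2)] c0(1) L by (intro frac_le) auto
          then show ?thesis by (simp add: mult_ac)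
        qed
        define e1 where "e1 = a1 * V t"
        define e2 where "e2 = a2 * y t + a3 * y t - a4 * V t"
        have yd': "(y has_vector_derivative (\<kappa> * of_real (r t) * V t + e1)) (at t)"
        proof -
          have "of_real (r t) * U t / C t = \<kappa> * of_real (r t) * V t + e1"
            unfolding UV[OF t(2)] e1_def a1_def using kt by (simp add: field_simps)
          then show ?thesis using yd by simp
        qed
        have Vd: "(V has_vector_derivative (\<kappa> * of_real (r t) * y t + e2)) (at t)"
        proof -
          have kd: "((\<lambda>t. \<kappa> * k t) has_vector_derivative \<kappa> * k' t) (at t)"
            by (rule has_vector_derivative_mult_right[OF k(1)[OF t(2)]])
          have "(inverse has_field_derivative - (inverse (\<kappa> * k t) ^ Suc (Suc 0))) (at (\<kappa> * k t))"
            using \<kappa> kt by (intro DERIV_inverse) simp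
          from field_vector_diff_chain_at[OF kd this]
          have "((\<lambda>t. inverse (\<kappa> * k t)) has_vector_derivative (\<kappa> * k' t) * - (inverse (\<kappa> * k t) ^ Suc (Suc 0))) (at t)"
            by (simp add: o_def)
          from has_vector_derivative_mult[OF Ud this]
          have "(V has_vector_derivative U t * ((\<kappa> * k' t) * - (inverse (\<kappa> * k t) ^ Suc (Suc 0))) +
              (q + \<kappa>\<^sup>2 * of_real (r t) * C t) * y t * inverse (\<kappa> * k t)) (at t)"
            by (simp add: V_def[abs_def] divide_inverse)
          moreover have "U t * ((\<kappa> * k' t) * - (inverse (\<kappa> * k t) ^ Suc (Suc 0))) +
              (q + \<kappa>\<^sup>2 * of_real (r t) * C t) * y t * inverse (\<kappa> * k t) = \<kappa> * of_real (r t) * y t + e2"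
            unfolding UV[OF t(2)] e2_def a2_def a3_def a4_def using kt \<kappa>
            by (simp add: field_simps power2_eq_square)
          ultimately show ?thesis by simp
        qed
        let ?P = "y t + V t" and ?M = "y t - V t"
        let ?\<kappa> = "\<kappa> * of_real (r t)"
        have yV: "norm (y t) + norm (V t) \<le> norm ?P + norm ?M"
        proof -
          have "2 * norm (y t) \<le> norm ?P + norm ?M" using norm_triangle_ineq[of ?P ?M]
            by (simp add: mult_2[symmetric] norm_mult flip: mult_2)
          moreover have "2 * norm (V t) \<le> norm ?P + norm ?M" using norm_triangle_ineq4[of ?P ?M]
            by (simp add: mult_2[symmetric] norm_mult flip: mult_2)
          ultimately show ?thesis by linarith
        qed
        have e: "norm e1 + norm e2 \<le> K * (norm ?P + norm ?M)"
        proof -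
          have "norm e1 + norm e2 \<le> norm a1 * norm (V t) + (norm a2 * norm (y t) + norm a3 * norm (y t) + norm a4 * norm (V t))"
            unfolding e1_def e2_def
            by (intro add_mono order_trans[OF norm_triangle_ineq4] order_trans[OF norm_triangle_ineq]) (auto simp: norm_mult)
          also have "\<dots> \<le> r1 * L / c0 * norm (V t) + (2 * r1 * L / c0 * norm (y t) + 2 * Q / c0 * norm (y t) + 2 * L / c0 * norm (V t))"
            using a1 a2 a3 a4 by (intro add_mono mult_right_mono) auto
          also have "\<dots> \<le> K * norm (V t) + K * norm (y t)"
          proof -
            have "(r1 * L / c0 + 2 * L / c0) * norm (V t) \<le> K * norm (V t)"
              using r1 L Q c0(1) by (intro mult_right_mono) (auto simp: K_def add_divide_distrib[symmetric] intro!: divide_right_mono)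
            moreover have "(2 * r1 * L / c0 + 2 * Q / c0) * norm (y t) \<le> K * norm (y t)"
              using r1 L Q c0(1) by (intro mult_right_mono) (auto simp: K_def add_divide_distrib[symmetric] intro!: divide_right_mono)
            ultimately show ?thesis by (simp add: algebra_simps)
          qed
          also have "\<dots> \<le> K * (norm ?P + norm ?M)"
            using mult_left_mono[OF yV K] by (simp add: algebra_simps)
          finally show ?thesis .
        qed
        show ?case
        proof (intro exI conjI)
          have "n * r0 \<le> (2 * Re \<kappa>) * r t"
            using Re\<kappa> rt n(1) r0 by (intro mult_mono) (auto simp: n_def)
          then show "n * r0 / 2 \<le> Re ?\<kappa>" by simp
          show "((\<lambda>t. y t + V t) has_vector_derivative (?\<kappa> * ?P + (e1 + e2))) (at t)"
            using has_vector_derivative_add[OF yd' Vd] by (simp add: algebra_simps)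
          show "((\<lambda>t. y t - V t) has_vector_derivative (- ?\<kappa> * ?M + (e1 - e2))) (at t)"
            using has_vector_derivative_diff[OF yd' Vd] by (simp add: algebra_simps)
          show "norm (e1 + e2) \<le> K * (norm ?P + norm ?M)" using e norm_triangle_ineq[of e1 e2] by linarith
          show "norm (e1 - e2) \<le> K * (norm ?P + norm ?M)" using e norm_triangle_ineq4[of e1 e2] by linarith
        qed
      qed
    qed
    ultimately have "norm (y v - V v) \<le> \<epsilon> / 2 * norm (y v + V v)"
    proof (intro cone_contraction[OF uv _ _ K _ _ lipschitz_on_add[OF y V] lipschitz_on_diff[OF y V], where A = "A + 1" and \<epsilon> = "\<epsilon> / 2" and \<rho> = "n * r0 / 2"])
      show "3 * K * (1 + (\<epsilon> / 2)\<^sup>2 + (A + 1)\<^sup>2) \<le> 2 * (n * r0 / 2)"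
        using n(2) r0 by (simp add: X1_def H_def[symmetric] pos_divide_le_eq)
      show "(A + 1)\<^sup>2 / (v - u) + 3 * K * (1 + (\<epsilon> / 2)\<^sup>2 + (A + 1)\<^sup>2) \<le> 2 * (n * r0 / 2) * (\<epsilon> / 2)\<^sup>2"
        using n(3) r0 \<epsilon> unfolding H_def[symmetric] X2_def by (subst (asm) pos_divide_le_eq) (auto simp: mult_ac)
    qed (use A \<epsilon> in auto)
    then have kv: "in_cone (\<epsilon> / 2) (k v) (y v) (U v / \<kappa>)" by (simp add: in_cone_def V_def)
    show "in_cone \<epsilon> (C v) (y v) (U v / \<kappa>)"
    proof (rule in_cone_perturb[OF _ _ _ _ _ _ kv])
      have "L / n = (L / c0 / n) * c0" using c0 by simp
      also have "\<dots> \<le> (2 * L / c0 / n) * norm (C v)"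
        using c0(1) c0(2)[of v] uv L n(1) by (intro mult_mono divide_right_mono) auto
      finally show "norm (C v - k v) \<le> (2 * L / c0 / n) * norm (C v)"
        using k(3)[of v] uv by (simp add: norm_minus_commute)
      show "(2 * L / c0 / n) * ((1 + \<epsilon> / 2) * (1 + \<epsilon>)) \<le> 2 * (\<epsilon> - \<epsilon> / 2)"
      proof -
        have "(2 * L / c0 / n) * ((1 + \<epsilon> / 2) * (1 + \<epsilon>)) = (X5 / n) * \<epsilon>" using \<epsilon> by (simp add: X5_def)
        moreover have "X5 / n \<le> 1" using n(1,6) by simp
        ultimately show ?thesis using \<epsilon> mult_right_mono[of "X5 / n" 1 \<epsilon>] by simp
      qed
    qed (use k0 uv \<epsilon> in auto)
  qed
qed

section \<open>The coefficients on one subinterval\<close>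

text \<open>All regularity of the coefficients on one subinterval, with a single constant \<open>N\<close>. The functions \<open>P\<close> and \<open>C\<close>
are extensions of \<open>p\<close> and of the product of \<open>p\<close> and \<open>r\<close> from the open interval, so their values at \<open>u\<close> and \<open>v\<close>
are the one-sided limits, whatever the coefficients do at these points.\<close>

definition segment_coeff :: "real \<Rightarrow> real \<Rightarrow> real \<Rightarrow> (real \<Rightarrow> complex) \<Rightarrow> (real \<Rightarrow> complex) \<Rightarrow>
    (real \<Rightarrow> real) \<Rightarrow> (real \<Rightarrow> complex) \<Rightarrow> (real \<Rightarrow> complex) \<Rightarrow> bool" where
  "segment_coeff N u v p w r P C \<longleftrightarrow> N > 0 \<and> N-lipschitz_on UNIV P \<and> N-lipschitz_on UNIV C \<and>
     (\<forall>t\<in>{u..v}. 1 / N \<le> norm (P t) \<and> 1 / N \<le> norm (C t)) \<and>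
     (\<forall>t\<in>{u<..<v}. P t = p t \<and> C t = p t * of_real (r t) \<and> w t = C t * of_real (r t) \<and>
        norm (w t) \<le> N \<and> 1 / N \<le> r t \<and> r t \<le> N)"

lemma segment_coeff_nonzero:
  assumes "segment_coeff N u v p w r P C" "t \<in> {u..v}"
  shows "P t \<noteq> 0" "C t \<noteq> 0"
proof -
  have "0 < 1 / N" "1 / N \<le> norm (P t)" "1 / N \<le> norm (C t)"
    using assms by (auto simp: segment_coeff_def)
  then show "P t \<noteq> 0" "C t \<noteq> 0" by auto
qed

lemma W2infty_extension:
  assumes W: "W2infty u v f" and uv: "u < v" and inf: "(INF t\<in>{u..v}. norm (closed_rep u v f t)) > 0"
  shows "\<exists>F L c B. L-lipschitz_on UNIV F \<and> (\<forall>t\<in>{u<..<v}. F t = f t) \<and> c > 0 \<and>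
    (\<forall>t\<in>{u..v}. c \<le> norm (F t) \<and> norm (F t) \<le> B)"
proof -
  obtain f1 where cont: "continuous_on {u<..<v} f" and f1: "Linfty {u<..<v} f1" "weak_deriv 1 u v f f1"
    using W unfolding W2infty_def by blast
  obtain C where C: "AE t in lebesgue_on {u<..<v}. norm (f1 t) \<le> C" using f1(1) unfolding Linfty_def by blast
  have "AE t in lebesgue_on {u<..<v}. norm (f1 t) \<le> max C 0" using C by eventually_elim auto
  then have "(max C 0)-lipschitz_on {u<..<v} f"
    by (intro weak_deriv_bounded_imp_lipschitz[OF cont f1(2)]) auto
  then obtain F where F: "(max C 0)-lipschitz_on UNIV F" "\<forall>t\<in>{u<..<v}. F t = f t"
    using lipschitz_extend_real[OF _ uv] by metis
  define c where "c = (INF t\<in>{u..v}. norm (closed_rep u v f t))"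
  have ge: "c \<le> norm (F t)" if t: "t \<in> {u<..<v}" for t
  proof -
    have "(f \<longlongrightarrow> f t) (at t within {u<..<v})" using cont t by (auto simp: continuous_on_def)
    moreover have "at t within {u<..<v} = at t" using t by (intro at_within_open) auto
    then have "at t within {u<..<v} \<noteq> bot" by simp
    ultimately have "closed_rep u v f t = f t" unfolding closed_rep_def by (intro tendsto_Lim)
    moreover have "c \<le> norm (closed_rep u v f t)"
      unfolding c_def by (rule cINF_lower) (use t in \<open>auto intro: bdd_belowI[of _ 0]\<close>)
    ultimately show ?thesis using F(2) t by simp
  qed
  have "(max C 0)-lipschitz_on {u..v} F" by (rule lipschitz_on_subset[OF F(1)]) auto
  from lipschitz_on_compact_bounded[OF this] obtain B where "\<forall>t\<in>{u..v}. norm (F t) \<le> B" by blast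
  moreover have "c > 0" using inf by (simp add: c_def)
  moreover have "\<forall>t\<in>{u..v}. c \<le> norm (F t)" using norm_ge_on_closed_interval[OF F(1) uv ge] by blast
  ultimately show ?thesis using F by blast
qed

text \<open>The regularity of \<open>r\<close> is inherited from \<open>p\<close> and \<open>w\<close>: \<open>r\<close> is the square root of the norm of \<open>w / p\<close>, which is
Lipschitz and bounded away from zero.\<close>

lemma segment_coeff_exists:
  assumes uv: "u < v" and p: "W2infty u v p" "(INF t\<in>{u..v}. norm (closed_rep u v p t)) > 0"
    and w: "W2infty u v w" "(INF t\<in>{u..v}. norm (closed_rep u v w t)) > 0"
    and r: "\<And>t. t \<in> {u<..<v} \<Longrightarrow> r t > 0 \<and> w t / p t = (of_real (r t))\<^sup>2"
  shows "\<exists>N P C. segment_coeff N u v p w r P C"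
proof -
  obtain P LP cP BP where P: "LP-lipschitz_on UNIV P" "\<forall>t\<in>{u<..<v}. P t = p t" "cP > 0"
    "\<forall>t\<in>{u..v}. cP \<le> norm (P t) \<and> norm (P t) \<le> BP" using W2infty_extension[OF p(1) uv p(2)] by metis
  obtain W LW cW BW where W: "LW-lipschitz_on UNIV W" "\<forall>t\<in>{u<..<v}. W t = w t" "cW > 0"
    "\<forall>t\<in>{u..v}. cW \<le> norm (W t) \<and> norm (W t) \<le> BW" using W2infty_extension[OF w(1) uv w(2)] by metis
  have BP: "BP > 0" "BW > 0" using P(3,4) W(3,4) uv by (force)+
  define R where "R t = sqrt (norm (W t * inverse (P t)))" for t
  have Rr: "R t = r t" if "t \<in> {u<..<v}" for t
  proof -
    have "norm (W t * inverse (P t)) = (r t)\<^sup>2"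
      using r[OF that] P(2) W(2) that by (simp add: divide_inverse[symmetric] norm_power)
    then show ?thesis using r[OF that] by (simp add: R_def)
  qed
  define r0 where "r0 = sqrt (cW / BP)"
  define r1 where "r1 = sqrt (BW / cP)"
  have r0: "r0 > 0" using W(3) BP by (simp add: r0_def)
  have P0: "P t \<noteq> 0" if "t \<in> {u..v}" for t using P(3,4) that by force
  have Rb: "r0 \<le> R t" "R t \<le> r1" if "t \<in> {u..v}" for t
    using P0[OF that] P(3,4) W(3,4) that BP unfolding R_def r0_def r1_def
    by (auto simp: norm_divide divide_inverse[symmetric] intro!: real_sqrt_le_mono frac_le)
  have Plip: "LP-lipschitz_on {u..v} P" and Wlip: "LW-lipschitz_on {u..v} W"
    by (rule lipschitz_on_subset[OF P(1)] lipschitz_on_subset[OF W(1)], simp)+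
  have "(LP / cP\<^sup>2)-lipschitz_on {u..v} (\<lambda>t. inverse (P t))"
    using P(3,4) by (intro lipschitz_on_inverse[OF Plip]) auto
  from lipschitz_on_bilinear[OF bounded_bilinear_mult Wlip this]
  obtain L1 where L1: "L1-lipschitz_on {u..v} (\<lambda>t. W t * inverse (P t))" by blast
  have "(L1 / (2 * r0))-lipschitz_on {u..v} R"
  proof (rule lipschitz_onI)
    fix s t assume st: "s \<in> {u..v}" "t \<in> {u..v}"
    have R2: "(R t)\<^sup>2 = norm (W t * inverse (P t))" for t by (simp add: R_def)
    have "2 * r0 * \<bar>R s - R t\<bar> \<le> (R s + R t) * \<bar>R s - R t\<bar>"
      using Rb(1)[OF st(1)] Rb(1)[OF st(2)] by (intro mult_right_mono) linarith+
    also have "\<dots> = \<bar>(R s)\<^sup>2 - (R t)\<^sup>2\<bar>"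
      using Rb(1)[OF st(1)] Rb(1)[OF st(2)] r0 by (simp add: power2_eq_square square_diff_square_factored abs_mult)
    also have "\<dots> \<le> norm (W s * inverse (P s) - W t * inverse (P t))" unfolding R2 by (rule norm_triangle_ineq3)
    also have "\<dots> \<le> L1 * norm (s - t)" by (rule lipschitz_on_normD[OF L1 st])
    finally show "dist (R s) (R t) \<le> L1 / (2 * r0) * dist s t"
      using r0 by (simp add: dist_norm field_simps)
  qed (use r0 L1 in \<open>auto dest: lipschitz_on_nonneg\<close>)
  from lipschitz_on_bilinear[OF bounded_bilinear_scaleR this Plip]
  obtain LC where "LC-lipschitz_on {u..v} (\<lambda>t. R t *\<^sub>R P t)" by blast
  then have "LC-lipschitz_on {u<..<v} (\<lambda>t. R t *\<^sub>R P t)" by (rule lipschitz_on_subset) auto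
  from lipschitz_extend_real[OF this uv] obtain C where C: "LC-lipschitz_on UNIV C"
    "\<forall>t\<in>{u<..<v}. C t = R t *\<^sub>R P t" by blast
  have Cge: "r0 * cP \<le> norm (C t)" if "t \<in> {u..v}" for t
  proof (rule norm_ge_on_closed_interval[OF C(1) uv _ that])
    fix t assume t: "t \<in> {u<..<v}"
    then have t': "t \<in> {u..v}" by auto
    have "r0 * cP \<le> R t * norm (P t)" using Rb[OF t'] P(3,4) t' r0 by (intro mult_mono) auto
    then show "r0 * cP \<le> norm (C t)" using C(2) t Rb(1)[OF t'] r0 by simp
  qed
  define N where "N = max LP (max LC (max (1 / cP) (max (1 / (r0 * cP)) (max BW (max (1 / r0) r1)))))"
  have N: "LP \<le> N" "LC \<le> N" "1 / cP \<le> N" "1 / (r0 * cP) \<le> N" "BW \<le> N" "1 / r0 \<le> N" "r1 \<le> N"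
    unfolding N_def by (simp_all only: le_max_iff_disj order_refl simp_thms)
  have N0: "N > 0" using N(3) P(3) by (meson less_le_trans zero_less_divide_1_iff)
  have inv: "1 / N \<le> c" if "1 / c \<le> N" "c > 0" for c using that N0 by (simp add: field_simps)
  have "segment_coeff N u v p w r P C"
    unfolding segment_coeff_def
  proof (intro conjI ballI N0)
    show "N-lipschitz_on UNIV P" "N-lipschitz_on UNIV C"
      using lipschitz_on_mono[OF P(1) _ N(1)] lipschitz_on_mono[OF C(1) _ N(2)] by auto
    fix t assume "t \<in> {u..v}"
    then show "1 / N \<le> norm (P t)" "1 / N \<le> norm (C t)"
      using inv[OF N(3)] inv[OF N(4)] P(3,4) r0 Cge by (force intro: order_trans)+
  next
    fix t assume t: "t \<in> {u<..<v}"
    then have t': "t \<in> {u..v}" by auto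
    show "P t = p t" using P(2) t by blast
    show C': "C t = p t * of_real (r t)" using C(2) P(2) Rr t by (simp add: scaleR_conv_of_real mult.commute)
    have "P t = p t" "W t = w t" using P(2) W(2) t by blast+
    then have "p t \<noteq> 0" using P0[OF t'] by simp
    then show "w t = C t * of_real (r t)" using r[OF t] unfolding C' by (simp add: field_simps power2_eq_square)
    show "norm (w t) \<le> N" using \<open>W t = w t\<close> W(4) t' N(5) by fastforce
    show "1 / N \<le> r t" "r t \<le> N" using Rb[OF t'] Rr[OF t] inv[OF N(6) r0] N(7) by auto
  qed
  then show ?thesis by blast
qed

section \<open>Solutions as a first-order system\<close>

text \<open>The properties of a solution and its quasi-derivative that the estimates use, which depend on the
potential only through the bound \<open>Q\<close>.\<close>

definition sl_system :: "real \<Rightarrow> real \<Rightarrow> (real \<Rightarrow> complex) \<Rightarrow> (real \<Rightarrow> complex) \<Rightarrow> real \<Rightarrow> complex \<Rightarrow>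
    (real \<Rightarrow> complex) \<Rightarrow> (real \<Rightarrow> complex) \<Rightarrow> bool" where
  "sl_system a b p w Q \<kappa> y U \<longleftrightarrow> (\<exists>L. L-lipschitz_on {a..b} y) \<and> (\<exists>L. L-lipschitz_on {a..b} U) \<and>
     (AE t in lebesgue_on {a..b}. (y has_vector_derivative U t / p t) (at t) \<and>
        (\<exists>q. norm q \<le> Q \<and> (U has_vector_derivative (q + \<kappa>\<^sup>2 * w t) * y t) (at t)))"

text \<open>The solution and its quasi-derivative are bounded by continuity, so the equations bound their derivatives
almost everywhere, and absolute continuity improves to Lipschitz continuity.\<close>

lemma sl_solution_imp_system:
  assumes sol: "sl_solution a b p q w \<mu> y" and N: "N > 0" and Q: "Q \<ge> 0"
    and pw: "AE t in lebesgue_on {a..b}. 1 / N \<le> norm (p t) \<and> norm (w t) \<le> N"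
    and q: "AE t in lebesgue_on {a..b}. norm (q t) \<le> Q" and \<kappa>: "\<kappa>\<^sup>2 = - \<mu>"
  shows "\<exists>U. sl_system a b p w Q \<kappa> y U"
proof -
  obtain U where y: "abs_cont_on a b y" and U: "abs_cont_on a b U"
    and ae1: "AE t in lebesgue_on {a..b}. y differentiable (at t) \<and> U t = p t * vector_derivative y (at t)"
    and ae2: "AE t in lebesgue_on {a..b}. U differentiable (at t) \<and>
            - vector_derivative U (at t) + q t * y t = \<mu> * w t * y t"
    using sol unfolding sl_solution_def by blast
  have bd: "\<exists>B\<ge>0. \<forall>t\<in>{a..b}. norm (f t) \<le> B" if "abs_cont_on a b f" for f
  proof -
    have "bounded (f ` {a..b})"
      by (intro compact_imp_bounded compact_continuous_image abs_cont_on_imp_continuous_on that) auto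
    then obtain B where "\<forall>t\<in>{a..b}. norm (f t) \<le> B" unfolding bounded_iff by auto
    then show ?thesis by (intro exI[of _ "max B 0"]) auto
  qed
  obtain By where By: "By \<ge> 0" "\<forall>t\<in>{a..b}. norm (y t) \<le> By" using bd[OF y] by blast
  obtain BU where BU: "BU \<ge> 0" "\<forall>t\<in>{a..b}. norm (U t) \<le> BU" using bd[OF U] by blast
  have "AE t in lebesgue_on {a..b}. t \<in> {a..b}" by (simp add: AE_restrict_space_iff)
  then have ae: "AE t in lebesgue_on {a..b}. t \<in> {a..b} \<and> (y has_vector_derivative U t / p t) (at t) \<and>
      norm (U t / p t) \<le> BU * N \<and>
      norm (q t) \<le> Q \<and> (U has_vector_derivative (q t + \<kappa>\<^sup>2 * w t) * y t) (at t) \<and>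
      norm ((q t + \<kappa>\<^sup>2 * w t) * y t) \<le> (Q + norm \<mu> * N) * By"
    using ae1 ae2 pw q
  proof eventually_elim
    case (elim t)
    have p0: "p t \<noteq> 0" using elim N by auto
    then have "vector_derivative y (at t) = U t / p t" using elim by (simp add: field_simps)
    then have 1: "(y has_vector_derivative U t / p t) (at t)"
      using elim vector_derivative_works by metis
    have "norm (U t) \<le> BU" "norm (y t) \<le> By" using BU(2) By(2) elim by blast+
    then have "norm (U t / p t) \<le> BU / (1 / N)"
      unfolding norm_divide using elim BU(1) N by (intro frac_le) auto
    then have 2: "norm (U t / p t) \<le> BU * N" by simp
    have "vector_derivative U (at t) = (q t + \<kappa>\<^sup>2 * w t) * y t"
      using elim \<kappa> by (simp add: algebra_simps)
    then have 3: "(U has_vector_derivative (q t + \<kappa>\<^sup>2 * w t) * y t) (at t)"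
      using elim vector_derivative_works by metis
    have "norm (q t + \<kappa>\<^sup>2 * w t) \<le> Q + norm \<mu> * N"
      using elim norm_triangle_ineq[of "q t" "\<kappa>\<^sup>2 * w t"] mult_left_mono[of "norm (w t)" N "norm \<mu>"]
      by (simp add: \<kappa> norm_mult)
    then have 4: "norm ((q t + \<kappa>\<^sup>2 * w t) * y t) \<le> (Q + norm \<mu> * N) * By"
      unfolding norm_mult using \<open>norm (y t) \<le> By\<close> By(1) Q N by (intro mult_mono) auto
    show ?case using 1 2 3 4 elim by blast
  qed
  have "AE t in lebesgue_on {a..b}. \<exists>d. (y has_vector_derivative d) (at t) \<and> norm d \<le> BU * N"
    using ae by eventually_elim blast
  then have "(BU * N)-lipschitz_on {a..b} y"
    using BU(1) N by (intro abs_cont_on_imp_lipschitz[OF y]) auto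
  moreover have "AE t in lebesgue_on {a..b}. \<exists>d. (U has_vector_derivative d) (at t) \<and>
      norm d \<le> (Q + norm \<mu> * N) * By"
    using ae by eventually_elim blast
  then have "((Q + norm \<mu> * N) * By)-lipschitz_on {a..b} U"
    using Q By(1) N by (intro abs_cont_on_imp_lipschitz[OF U]) auto
  moreover have "AE t in lebesgue_on {a..b}. (y has_vector_derivative U t / p t) (at t) \<and>
        (\<exists>q. norm q \<le> Q \<and> (U has_vector_derivative (q + \<kappa>\<^sup>2 * w t) * y t) (at t))"
    using ae by eventually_elim blast
  ultimately show ?thesis unfolding sl_system_def by blast
qed

lemma sl_system_subinterval:
  assumes "sl_system a b p w Q \<kappa> y U" "a \<le> u" "v \<le> b"
  shows "sl_system u v p w Q \<kappa> y U"
proof -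
  have sub: "{u..v} \<subseteq> {a..b}" using assms by auto
  obtain Ly LU where L: "Ly-lipschitz_on {a..b} y" "LU-lipschitz_on {a..b} U"
    and ae: "AE t in lebesgue_on {a..b}. (y has_vector_derivative U t / p t) (at t) \<and>
        (\<exists>q. norm q \<le> Q \<and> (U has_vector_derivative (q + \<kappa>\<^sup>2 * w t) * y t) (at t))"
    using assms(1) unfolding sl_system_def by blast
  show ?thesis
    unfolding sl_system_def
  proof (intro conjI exI)
    show "Ly-lipschitz_on {u..v} y" "LU-lipschitz_on {u..v} U"
      by (rule lipschitz_on_subset[OF L(1) sub] lipschitz_on_subset[OF L(2) sub])+
  qed (rule AE_lebesgue_on_subset[OF ae sub]; simp)
qed

lemma linear_system_uniqueness:
  fixes y U :: "real \<Rightarrow> complex"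
  assumes y: "Ly-lipschitz_on {a..b} y" and U: "LU-lipschitz_on {a..b} U" and K: "K \<ge> 0"
    and ae: "AE t in lebesgue_on {a..b}. \<exists>\<alpha> \<beta>. norm \<alpha> \<le> K \<and> norm \<beta> \<le> K \<and>
      (y has_vector_derivative \<alpha> * U t) (at t) \<and> (U has_vector_derivative \<beta> * y t) (at t)"
    and zero: "y b = 0" "U b = 0" and t: "t \<in> {a..b}"
  shows "y t = 0"
proof -
  \<comment> \<open>\<open>N\<close> decreases at most exponentially, so \<open>N * E\<close> is nondecreasing and vanishes at \<open>b\<close>\<close>
  define N where "N t = y t \<bullet> y t + U t \<bullet> U t" for t
  define E where "E t = exp (2 * K * t)" for t
  have lipE: "(2 * K * exp (2 * K * b))-lipschitz_on {t..b} E"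
  proof (rule bounded_derivative_imp_lipschitz)
    fix s assume s: "s \<in> {t..b}"
    show "(E has_derivative (\<lambda>h. h *\<^sub>R (2 * K * E s))) (at s within {t..b})"
      unfolding E_def by (auto intro!: derivative_eq_intros)
    have "E s \<le> exp (2 * K * b)" using mult_left_mono[of s b "2 * K"] s K by (simp add: E_def)
    then have le: "2 * K * E s \<le> 2 * K * exp (2 * K * b)" using K by (intro mult_left_mono) auto
    have "0 \<le> 2 * K * E s" using K by (simp add: E_def)
    then have "norm (h *\<^sub>R (2 * K * E s)) \<le> 2 * K * exp (2 * K * b) * norm h" for h
      using mult_right_mono[OF le, of "\<bar>h\<bar>"] K by (simp add: abs_mult mult_ac E_def)
    then show "onorm (\<lambda>h. h *\<^sub>R (2 * K * E s)) \<le> 2 * K * exp (2 * K * b)"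
      using K by (intro onorm_bound) auto
  qed (use K in auto)
  have yU: "Ly-lipschitz_on {t..b} y" "LU-lipschitz_on {t..b} U"
    using t by (auto intro: lipschitz_on_subset[OF y] lipschitz_on_subset[OF U])
  obtain C1 where C1: "C1-lipschitz_on {t..b} (\<lambda>t. y t \<bullet> y t)"
    using lipschitz_on_bilinear[OF bounded_bilinear_inner yU(1) yU(1)] by blast
  obtain C2 where C2: "C2-lipschitz_on {t..b} (\<lambda>t. U t \<bullet> U t)"
    using lipschitz_on_bilinear[OF bounded_bilinear_inner yU(2) yU(2)] by blast
  have lipN: "(C1 + C2)-lipschitz_on {t..b} N" unfolding N_def by (rule lipschitz_on_add[OF C1 C2])
  obtain C3 where C3: "C3-lipschitz_on {t..b} (\<lambda>t. N t * E t)"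
    using lipschitz_on_bilinear[OF bounded_bilinear_mult lipN lipE] by blast
  have ae': "AE s in lebesgue_on {t..b}. \<exists>\<alpha> \<beta>. norm \<alpha> \<le> K \<and> norm \<beta> \<le> K \<and>
      (y has_vector_derivative \<alpha> * U s) (at s) \<and> (U has_vector_derivative \<beta> * y s) (at s)"
    by (rule AE_lebesgue_on_subset[OF ae]) (use t in auto)
  have "- (N b * E b) \<le> - (N t * E t)"
  proof (rule lipschitz_on_decreasing[where f = "\<lambda>s. - (N s * E s)"])
    show "C3-lipschitz_on {t..b} (\<lambda>s. - (N s * E s))" by (rule lipschitz_on_minus[OF C3])
    show "AE s in lebesgue_on {t..b}. \<exists>d. ((\<lambda>s. - (N s * E s)) has_real_derivative d) (at s) \<and> d \<le> 0"
      using ae'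
    proof eventually_elim
      case (elim s)
      then obtain \<alpha> \<beta> where \<alpha>\<beta>: "norm \<alpha> \<le> K" "norm \<beta> \<le> K"
        and yd: "(y has_vector_derivative \<alpha> * U s) (at s)" and Ud: "(U has_vector_derivative \<beta> * y s) (at s)"
        by blast
      define n where "n = 2 * (y s \<bullet> (\<alpha> * U s)) + 2 * (U s \<bullet> (\<beta> * y s))"
      have "(N has_real_derivative n) (at s)"
        unfolding N_def n_def
        using has_vector_derivative_add[OF bounded_bilinear.has_vector_derivative[OF bounded_bilinear_inner yd yd]
            bounded_bilinear.has_vector_derivative[OF bounded_bilinear_inner Ud Ud]]
        by (simp add: has_real_derivative_iff_has_vector_derivative inner_commute)
      moreover have "(E has_real_derivative 2 * K * E s) (at s)"
        unfolding E_def by (auto intro!: derivative_eq_intros)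
      ultimately have "((\<lambda>s. - (N s * E s)) has_real_derivative - (n * E s + (2 * K * E s) * N s)) (at s)"
        by (intro DERIV_minus DERIV_mult)
      moreover have "- (n * E s + (2 * K * E s) * N s) \<le> 0"
      proof -
        let ?Y = "norm (y s)" and ?V = "norm (U s)"
        have "\<bar>y s \<bullet> (\<alpha> * U s)\<bar> \<le> ?Y * (K * ?V)"
          using \<alpha>\<beta> by (intro order_trans[OF Cauchy_Schwarz_ineq2] mult_left_mono) (auto simp: norm_mult intro: mult_right_mono)
        moreover have "\<bar>U s \<bullet> (\<beta> * y s)\<bar> \<le> ?V * (K * ?Y)"
          using \<alpha>\<beta> by (intro order_trans[OF Cauchy_Schwarz_ineq2] mult_left_mono) (auto simp: norm_mult intro: mult_right_mono)
        ultimately have "n \<ge> - (2 * K * (2 * (?Y * ?V)))" unfolding n_def by (simp add: algebra_simps)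
        moreover have "2 * (?Y * ?V) \<le> N s"
          using zero_le_power2[of "?Y - ?V"] by (simp add: N_def power2_diff power2_norm_eq_inner)
        then have "2 * K * (2 * (?Y * ?V)) \<le> 2 * K * N s" using K by (intro mult_left_mono) auto
        ultimately have "0 \<le> n + 2 * K * N s" by linarith
        then have "0 \<le> (n + 2 * K * N s) * E s" by (intro mult_nonneg_nonneg) (auto simp: E_def)
        then show ?thesis by (simp add: algebra_simps)
      qed
      ultimately show ?case by blast
    qed
  qed (use t in auto)
  then have "N t * E t \<le> 0" by (simp add: N_def zero)
  then have "N t \<le> 0" by (simp add: E_def mult_le_0_iff)
  then have "y t \<bullet> y t \<le> 0" using inner_ge_zero[of "U t"] unfolding N_def by linarith
  then show ?thesis using inner_ge_zero[of "y t"] by (metis antisym inner_eq_zero_iff)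
qed

lemma sl_system_uniqueness:
  assumes sys: "sl_system a b p w Q \<kappa> y U" and N: "N > 0" and Q: "Q \<ge> 0"
    and pw: "AE t in lebesgue_on {a..b}. 1 / N \<le> norm (p t) \<and> norm (w t) \<le> N"
    and zero: "y b = 0" "U b = 0" and t: "t \<in> {a..b}"
  shows "y t = 0"
proof -
  obtain Ly LU where L: "Ly-lipschitz_on {a..b} y" "LU-lipschitz_on {a..b} U"
    and ae: "AE t in lebesgue_on {a..b}. (y has_vector_derivative U t / p t) (at t) \<and>
        (\<exists>q. norm q \<le> Q \<and> (U has_vector_derivative (q + \<kappa>\<^sup>2 * w t) * y t) (at t))"
    using sys unfolding sl_system_def by blast
  define K where "K = N + (Q + norm (\<kappa>\<^sup>2) * N)"
  have K: "K \<ge> 0" "N \<le> K" "Q + norm (\<kappa>\<^sup>2) * N \<le> K" using N Q by (auto simp: K_def)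
  have "AE t in lebesgue_on {a..b}. \<exists>\<alpha> \<beta>. norm \<alpha> \<le> K \<and> norm \<beta> \<le> K \<and>
      (y has_vector_derivative \<alpha> * U t) (at t) \<and> (U has_vector_derivative \<beta> * y t) (at t)"
    using ae pw
  proof eventually_elim
    case (elim t)
    then obtain q where q: "norm q \<le> Q" "(U has_vector_derivative (q + \<kappa>\<^sup>2 * w t) * y t) (at t)" by blast
    have "norm (1 / p t) \<le> 1 / (1 / N)"
      unfolding norm_divide using elim N by (intro frac_le) auto
    then have 1: "norm (1 / p t) \<le> K" using K by simp
    have "norm (q + \<kappa>\<^sup>2 * w t) \<le> Q + norm (\<kappa>\<^sup>2) * N"
      using elim q(1) norm_triangle_ineq[of q "\<kappa>\<^sup>2 * w t"] mult_left_mono[of "norm (w t)" N "norm (\<kappa>\<^sup>2)"]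
      by (simp add: norm_mult)
    then have 2: "norm (q + \<kappa>\<^sup>2 * w t) \<le> K" using K by simp
    show ?case
      by (rule exI[of _ "1 / p t"], rule exI[of _ "q + \<kappa>\<^sup>2 * w t"]) (use 1 2 q elim in simp)
  qed
  then show ?thesis by (rule linear_system_uniqueness[OF L K(1) _ zero t])
qed

text \<open>At an endpoint \<open>t\<close> the function \<open>y\<close> has the one-sided derivative \<open>U t / P t\<close>, because \<open>U / P\<close> is a continuous
representative of its almost everywhere derivative.\<close>

lemma neumann_imp_quasi_derivative_zero:
  assumes uv: "u < v" and sc: "segment_coeff N u v p w r P C" and sys: "sl_system u v p w Q \<kappa> y U"
    and t: "t \<in> {u..v}" and sub: "{u..v} \<subseteq> S" and y': "(y has_vector_derivative 0) (at t within S)"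
  shows "U t = 0"
proof -
  obtain Ly LU where L: "Ly-lipschitz_on {u..v} y" "LU-lipschitz_on {u..v} U"
    and ae: "AE t in lebesgue_on {u..v}. (y has_vector_derivative U t / p t) (at t) \<and>
        (\<exists>q. norm q \<le> Q \<and> (U has_vector_derivative (q + \<kappa>\<^sup>2 * w t) * y t) (at t))"
    using sys unfolding sl_system_def by blast
  have N: "1 / N > 0" and P: "N-lipschitz_on UNIV P" "\<And>t. t \<in> {u..v} \<Longrightarrow> 1 / N \<le> norm (P t)"
    "\<And>t. t \<in> {u<..<v} \<Longrightarrow> P t = p t"
    using sc by (auto simp: segment_coeff_def)
  have P0: "P t \<noteq> 0" if "t \<in> {u..v}" for t using P(2)[OF that] N by auto
  have "AE t in lebesgue_on {u..v}. t \<notin> {u, v}" by (rule AE_lebesgue_on_not_in_finite) auto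
  moreover have "AE t in lebesgue_on {u..v}. t \<in> {u..v}" by (simp add: AE_restrict_space_iff)
  ultimately have "AE t in lebesgue_on {u..v}. (y has_vector_derivative U t / P t) (at t)"
    using ae
  proof eventually_elim
    case (elim t)
    then have "t \<in> {u<..<v}" by auto
    then show ?case using elim P(3) by simp
  qed
  moreover have "continuous_on {u..v} (\<lambda>t. U t / P t)"
    using P0 lipschitz_on_continuous_on[OF L(2)] lipschitz_on_continuous_on[OF P(1)]
    by (intro continuous_intros) (auto intro: continuous_on_subset)
  ultimately have "(y has_vector_derivative U t / P t) (at t within {u..v})"
    using has_vector_derivative_of_ae_continuous[OF L(1) _ _ t] by blast
  moreover have "(y has_vector_derivative 0) (at t within {u..v})"
    by (rule has_vector_derivative_within_subset[OF y' sub])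
  ultimately have "U t / P t = 0"
    using vector_derivative_unique_within_closed_interval[of u v t y] uv t by (metis box_real(2))
  then show ?thesis using P0[OF t] by simp
qed

lemma segment_cone_contraction:
  assumes uv: "u < v" and sc: "segment_coeff N u v p w r P C" and A: "A \<ge> 0" and \<epsilon>: "\<epsilon> > 0" and Q: "Q \<ge> 0"
  shows "\<exists>K0. \<forall>\<kappa> y U. norm \<kappa> \<ge> K0 \<longrightarrow> 2 * Re \<kappa> \<ge> norm \<kappa> \<longrightarrow> sl_system u v p w Q \<kappa> y U \<longrightarrow>
      in_cone A (C u) (y u) (U u / \<kappa>) \<longrightarrow> in_cone \<epsilon> (C v) (y v) (U v / \<kappa>)"
proof -
  have N: "N > 0" "1 / N > 0" and C: "N-lipschitz_on UNIV C" "\<And>t. t \<in> {u..v} \<Longrightarrow> 1 / N \<le> norm (C t)"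
    and r: "\<And>t. t \<in> {u<..<v} \<Longrightarrow> 1 / N \<le> r t \<and> r t \<le> N"
    and eqs: "\<And>t. t \<in> {u<..<v} \<Longrightarrow> C t = p t * of_real (r t) \<and> w t = C t * of_real (r t)"
    using sc by (auto simp: segment_coeff_def)
  have "\<exists>K0. \<forall>\<kappa> y U Ly LU. norm \<kappa> \<ge> K0 \<longrightarrow> 2 * Re \<kappa> \<ge> norm \<kappa> \<longrightarrow>
      Ly-lipschitz_on {u..v} y \<longrightarrow> LU-lipschitz_on {u..v} U \<longrightarrow>
      (AE t in lebesgue_on {u..v}. \<exists>q. norm q \<le> Q \<and>
         (y has_vector_derivative of_real (r t) * U t / C t) (at t) \<and>
         (U has_vector_derivative (q + \<kappa>\<^sup>2 * of_real (r t) * C t) * y t) (at t)) \<longrightarrow>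
      in_cone A (C u) (y u) (U u / \<kappa>) \<longrightarrow> in_cone \<epsilon> (C v) (y v) (U v / \<kappa>)" (is "\<exists>K0. ?G K0")
    by (rule segment_contraction[OF uv A \<epsilon> C(1) N(2) _ N(2) _ Q]) (use C(2) r in auto)
  then obtain K0 where K0: "?G K0" by (elim exE)
  show ?thesis
  proof (intro exI[of _ K0] allI impI)
    fix \<kappa> y U assume \<kappa>: "norm \<kappa> \<ge> K0" "2 * Re \<kappa> \<ge> norm \<kappa>" and sys: "sl_system u v p w Q \<kappa> y U"
      and start: "in_cone A (C u) (y u) (U u / \<kappa>)"
    obtain Ly LU where L: "Ly-lipschitz_on {u..v} y" "LU-lipschitz_on {u..v} U"
      and ae: "AE t in lebesgue_on {u..v}. (y has_vector_derivative U t / p t) (at t) \<and>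
        (\<exists>q. norm q \<le> Q \<and> (U has_vector_derivative (q + \<kappa>\<^sup>2 * w t) * y t) (at t))"
      using sys unfolding sl_system_def by blast
    have "AE t in lebesgue_on {u..v}. \<exists>q. norm q \<le> Q \<and>
         (y has_vector_derivative of_real (r t) * U t / C t) (at t) \<and>
         (U has_vector_derivative (q + \<kappa>\<^sup>2 * of_real (r t) * C t) * y t) (at t)"
    proof -
      have "AE t in lebesgue_on {u..v}. t \<notin> {u, v}" by (rule AE_lebesgue_on_not_in_finite) auto
      moreover have "AE t in lebesgue_on {u..v}. t \<in> {u..v}" by (simp add: AE_restrict_space_iff)
      ultimately show ?thesis using ae
      proof eventually_elim
        case (elim t)
        then have t: "t \<in> {u<..<v}" by auto
        have rt: "r t \<noteq> 0" using r[OF t] N by auto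
        have 1: "of_real (r t) * U t / C t = U t / p t" using eqs[OF t] rt by simp
        have 2: "\<kappa>\<^sup>2 * of_real (r t) * C t = \<kappa>\<^sup>2 * w t" using eqs[OF t] by (simp add: mult_ac)
        show ?case unfolding 1 2 using elim by blast
      qed
    qed
    then show "in_cone \<epsilon> (C v) (y v) (U v / \<kappa>)" using K0[rule_format, OF \<kappa> L _ start] by simp
  qed
qed

section \<open>Passing through the partition\<close>

lemma partition_mono:
  fixes x :: "nat \<Rightarrow> real"
  assumes "\<forall>j\<in>{1..m}. x (j - 1) < x j" "i \<le> j" "j \<le> m"
  shows "x i \<le> x j"
  using assms(2,3)
proof (induction j rule: dec_induct)
  case (step n)
  then show ?case using assms(1)[rule_format, of "Suc n"] by simp
qed simp

lemma partition_cover: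
  fixes x :: "nat \<Rightarrow> real"
  assumes "\<forall>j\<in>{1..m}. x (j - 1) < x j" "t \<in> {x 0..x m}" "t \<notin> x ` {..m}"
  shows "\<exists>j\<in>{1..m}. t \<in> {x (j - 1)<..<x j}"
  using assms
proof (induction m)
  case (Suc m)
  have "t \<noteq> x m" "t \<noteq> x (Suc m)" using Suc.prems(3) by auto
  then show ?case
  proof (cases "t < x m")
    case True
    then have "\<exists>j\<in>{1..m}. t \<in> {x (j - 1)<..<x j}" using Suc.prems by (intro Suc.IH) auto
    then show ?thesis by force
  next
    case False
    then show ?thesis using Suc.prems(2) \<open>t \<noteq> x m\<close> \<open>t \<noteq> x (Suc m)\<close> by (intro bexI[of _ "Suc m"]) auto
  qed
qed auto

lemma periodic_ext_eq: "t \<in> {a..<b} \<Longrightarrow> periodic_ext a b f t = f t"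
proof -
  assume "t \<in> {a..<b}"
  then have "\<lfloor>(t - a) / (b - a)\<rfloor> = 0" by (intro floor_unique) auto
  then show ?thesis by (simp add: periodic_ext_def)
qed

lemma Lim_right_periodic_ext:
  fixes f C :: "real \<Rightarrow> complex"
  assumes C: "N-lipschitz_on UNIV C" "\<And>t. t \<in> {u<..<v} \<Longrightarrow> f t = C t" and uv: "u < v" "a \<le> u" "v \<le> b"
  shows "Lim (at_right u) (periodic_ext a b f) = C u"
proof (rule tendsto_Lim)
  have "isCont C u" using lipschitz_on_continuous_on[OF C(1)] by (simp add: continuous_on_eq_continuous_at)
  then have "(C \<longlongrightarrow> C u) (at_right u)" by (auto simp: isCont_def intro: filterlim_at_split[THEN iffD1, THEN conjunct2])
  moreover have "\<forall>\<^sub>F t in at_right u. C t = periodic_ext a b f t"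
    unfolding eventually_at_right_field using uv C(2) periodic_ext_eq[of _ a b f]
    by (intro exI[of _ v]) auto
  ultimately show "(periodic_ext a b f \<longlongrightarrow> C u) (at_right u)" by (rule Lim_transform_eventually)
qed simp

lemma Lim_left_periodic_ext:
  fixes f C :: "real \<Rightarrow> complex"
  assumes C: "N-lipschitz_on UNIV C" "\<And>t. t \<in> {u<..<v} \<Longrightarrow> f t = C t" and uv: "u < v" "a \<le> u" "v \<le> b"
  shows "Lim (at_left v) (periodic_ext a b f) = C v"
proof (rule tendsto_Lim)
  have "isCont C v" using lipschitz_on_continuous_on[OF C(1)] by (simp add: continuous_on_eq_continuous_at)
  then have "(C \<longlongrightarrow> C v) (at_left v)" by (auto simp: isCont_def intro: filterlim_at_split[THEN iffD1, THEN conjunct1])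
  moreover have "\<forall>\<^sub>F t in at_left v. C t = periodic_ext a b f t"
    unfolding eventually_at_left_field using uv C(2) periodic_ext_eq[of _ a b f]
    by (intro exI[of _ u]) auto
  ultimately show "(periodic_ext a b f \<longlongrightarrow> C v) (at_left v)" by (rule Lim_transform_eventually)
qed simp

text \<open>Induction over the subintervals. Each interface needs a cone of a particular opening \<open>\<alpha>\<close>, which the
contraction on the previous subinterval provides; this is why the claim is proved for all \<open>\<epsilon>\<close> at once.\<close>

lemma iterated_cone_contraction:
  fixes x :: "nat \<Rightarrow> real" and C :: "nat \<Rightarrow> real \<Rightarrow> complex"
  assumes part: "\<forall>j\<in>{1..m}. x (j - 1) < x j" and m: "m \<ge> 1"
    and sc: "\<And>j. j \<in> {1..m} \<Longrightarrow> segment_coeff (N j) (x (j - 1)) (x j) p w r (P j) (C j)"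
    and jump: "\<And>j. 1 \<le> j \<Longrightarrow> j < m \<Longrightarrow> C (Suc j) (x j) + C j (x j) \<noteq> 0"
    and Q: "Q \<ge> 0" and j: "1 \<le> j" "j \<le> m" and \<epsilon>: "\<epsilon> > 0"
  shows "\<exists>K0. \<forall>\<kappa> y U. norm \<kappa> \<ge> K0 \<longrightarrow> 2 * Re \<kappa> \<ge> norm \<kappa> \<longrightarrow> sl_system (x 0) (x m) p w Q \<kappa> y U \<longrightarrow>
      y (x 0) = 0 \<or> U (x 0) = 0 \<longrightarrow> in_cone \<epsilon> (C j (x j)) (y (x j)) (U (x j) / \<kappa>)"
  using j \<epsilon>
proof (induction j arbitrary: \<epsilon> rule: dec_induct)
  case base
  have seg: "x 0 < x 1" "segment_coeff (N 1) (x 0) (x 1) p w r (P 1) (C 1)"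
    using part[rule_format, of 1] m sc[of 1] by auto
  obtain K0 where K0: "\<forall>\<kappa> y U. norm \<kappa> \<ge> K0 \<longrightarrow> 2 * Re \<kappa> \<ge> norm \<kappa> \<longrightarrow> sl_system (x 0) (x 1) p w Q \<kappa> y U \<longrightarrow>
      in_cone 1 (C 1 (x 0)) (y (x 0)) (U (x 0) / \<kappa>) \<longrightarrow> in_cone \<epsilon> (C 1 (x 1)) (y (x 1)) (U (x 1) / \<kappa>)"
    using segment_cone_contraction[OF seg zero_le_one base(2) Q] by (elim exE)
  have le: "x 1 \<le> x m" using partition_mono[OF part m] by simp
  show ?case
  proof (intro exI[of _ K0] allI impI)
    fix \<kappa> y U assume \<kappa>: "norm \<kappa> \<ge> K0" "2 * Re \<kappa> \<ge> norm \<kappa>" and sys: "sl_system (x 0) (x m) p w Q \<kappa> y U"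
      and bc: "y (x 0) = 0 \<or> U (x 0) = 0"
    have "sl_system (x 0) (x 1) p w Q \<kappa> y U" by (rule sl_system_subinterval[OF sys order_refl le])
    moreover have "in_cone 1 (C 1 (x 0)) (y (x 0)) (U (x 0) / \<kappa>)" by (rule in_cone_start) (use bc in auto)
    ultimately show "in_cone \<epsilon> (C 1 (x 1)) (y (x 1)) (U (x 1) / \<kappa>)" using K0 \<kappa> by blast
  qed
next
  case (step j)
  then have j: "1 \<le> j" "j < m" by auto
  have seg: "x j < x (Suc j)" "segment_coeff (N (Suc j)) (x j) (x (Suc j)) p w r (P (Suc j)) (C (Suc j))"
    using part[rule_format, of "Suc j"] sc[of "Suc j"] j by auto
  have prev: "x (j - 1) < x j" "segment_coeff (N j) (x (j - 1)) (x j) p w r (P j) (C j)"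
    using part[rule_format, of j] sc[of j] j by auto
  have nz: "C j (x j) \<noteq> 0" "C (Suc j) (x j) \<noteq> 0"
    using prev(1) seg(1) by (auto intro!: segment_coeff_nonzero[OF prev(2)] segment_coeff_nonzero[OF seg(2)])
  obtain \<alpha> \<beta> where \<alpha>: "\<alpha> > 0" and \<beta>: "\<beta> \<ge> 0"
    and cross: "\<And>y z. in_cone \<alpha> (C j (x j)) y z \<Longrightarrow> in_cone \<beta> (C (Suc j) (x j)) y z"
    using in_cone_interface[OF nz jump[OF j]] by blast
  obtain K1 where K1: "\<forall>\<kappa> y U. norm \<kappa> \<ge> K1 \<longrightarrow> 2 * Re \<kappa> \<ge> norm \<kappa> \<longrightarrow> sl_system (x 0) (x m) p w Q \<kappa> y U \<longrightarrow>
      y (x 0) = 0 \<or> U (x 0) = 0 \<longrightarrow> in_cone \<alpha> (C j (x j)) (y (x j)) (U (x j) / \<kappa>)"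
    using step.IH[OF _ \<alpha>] j by auto
  obtain K2 where K2: "\<forall>\<kappa> y U. norm \<kappa> \<ge> K2 \<longrightarrow> 2 * Re \<kappa> \<ge> norm \<kappa> \<longrightarrow> sl_system (x j) (x (Suc j)) p w Q \<kappa> y U \<longrightarrow>
      in_cone \<beta> (C (Suc j) (x j)) (y (x j)) (U (x j) / \<kappa>) \<longrightarrow>
      in_cone \<epsilon> (C (Suc j) (x (Suc j))) (y (x (Suc j))) (U (x (Suc j)) / \<kappa>)"
    using segment_cone_contraction[OF seg \<beta> step.prems(2) Q] by (elim exE)
  have le: "x 0 \<le> x j" "x (Suc j) \<le> x m"
    using partition_mono[OF part, of 0 j] partition_mono[OF part, of "Suc j" m] j by auto
  show ?case
  proof (intro exI[of _ "max K1 K2"] allI impI)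
    fix \<kappa> y U assume \<kappa>: "norm \<kappa> \<ge> max K1 K2" "2 * Re \<kappa> \<ge> norm \<kappa>" and sys: "sl_system (x 0) (x m) p w Q \<kappa> y U"
      and bc: "y (x 0) = 0 \<or> U (x 0) = 0"
    have "in_cone \<alpha> (C j (x j)) (y (x j)) (U (x j) / \<kappa>)" using K1[rule_format, OF _ \<kappa>(2) sys bc] \<kappa>(1) by simp
    then have start: "in_cone \<beta> (C (Suc j) (x j)) (y (x j)) (U (x j) / \<kappa>)" by (rule cross)
    have sys': "sl_system (x j) (x (Suc j)) p w Q \<kappa> y U" by (rule sl_system_subinterval[OF sys le])
    show "in_cone \<epsilon> (C (Suc j) (x (Suc j))) (y (x (Suc j))) (U (x (Suc j)) / \<kappa>)"
      using K2[rule_format, OF _ \<kappa>(2) sys' start] \<kappa>(1) by simp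
  qed
qed

section \<open>Boundedness of the eigenvalues in the left half-plane\<close>

lemma csqrt_left_half_plane:
  assumes "Re \<mu> < 0"
  shows "2 * Re (csqrt (- \<mu>)) \<ge> norm (csqrt (- \<mu>))"
proof -
  define \<kappa> where "\<kappa> = csqrt (- \<mu>)"
  have "\<kappa>\<^sup>2 = - \<mu>" by (simp add: \<kappa>_def)
  then have "(Re \<kappa>)\<^sup>2 - (Im \<kappa>)\<^sup>2 = - Re \<mu>" by (metis Re_power2 uminus_complex.sel(1))
  then have "(Im \<kappa>)\<^sup>2 \<le> 3 * (Re \<kappa>)\<^sup>2" using assms zero_le_power2[of "Re \<kappa>"] by linarith
  then have "(norm \<kappa>)\<^sup>2 \<le> (2 * Re \<kappa>)\<^sup>2" unfolding cmod_power2 power_mult_distrib by simp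
  moreover have "Re \<kappa> \<ge> 0" using csqrt_principal[of "- \<mu>"] by (auto simp: \<kappa>_def)
  ultimately show ?thesis unfolding \<kappa>_def[symmetric] by (meson mult_nonneg_nonneg power2_le_imp_le zero_le_numeral)
qed

theorem corollary3p3:
  fixes a b :: real and m :: nat and x :: "nat \<Rightarrow> real"
    and p q w :: "real \<Rightarrow> complex" and r :: "real \<Rightarrow> real"
  assumes "m \<ge> 1" and "x 0 = a" and "x m = b" and "\<forall>j\<in>{1..m}. x (j - 1) < x j"
    and "\<forall>j\<in>{1..m}. W2infty (x (j - 1)) (x j) p \<and> W2infty (x (j - 1)) (x j) w"
    and "\<forall>j\<in>{1..m}. (INF t\<in>{x (j - 1)..x j}. norm (closed_rep (x (j - 1)) (x j) p t)) > 0"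
    and "\<forall>j\<in>{1..m}. (INF t\<in>{x (j - 1)..x j}. norm (closed_rep (x (j - 1)) (x j) w t)) > 0"
    and "\<forall>t\<in>{a..b}. r t > 0 \<and> w t / p t = (of_real (r t))\<^sup>2"
    and "Linfty {a..b} q"
    and "\<forall>j\<in>{1..m}.
           Lim (at_right (x j)) (periodic_ext a b (\<lambda>t. p t * of_real (r t))) +
           Lim (at_left (x j)) (periodic_ext a b (\<lambda>t. p t * of_real (r t))) \<noteq> 0"
  shows "\<forall>bc \<in> {dirichlet_bc, neumann_bc}.
           \<exists>R0>0. \<forall>\<mu>. sl_eigenvalue bc a b p q w \<mu> \<and> Re \<mu> < 0 \<longrightarrow> norm \<mu> < R0"
proof -
  note m = assms(1) and xa = assms(2) and xb = assms(3) and part = assms(4)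
  have xj: "a \<le> x (j - 1)" "x (j - 1) < x j" "x j \<le> b" if "j \<in> {1..m}" for j
    using partition_mono[OF part, of 0 "j - 1"] partition_mono[OF part, of j m] part that xa xb by auto
  have "\<exists>N P C. segment_coeff N (x (j - 1)) (x j) p w r P C" if j: "j \<in> {1..m}" for j
  proof (rule segment_coeff_exists)
    fix t assume "t \<in> {x (j - 1)<..<x j}"
    then show "0 < r t \<and> w t / p t = (of_real (r t))\<^sup>2" using assms(8) xj[OF j] by simp
  qed (use assms(5-7) xj j in auto)
  then obtain N P C where sc: "\<And>j. j \<in> {1..m} \<Longrightarrow> segment_coeff (N j) (x (j - 1)) (x j) p w r (P j) (C j)"
    by metis
  have jump: "C (Suc j) (x j) + C j (x j) \<noteq> 0" if j: "1 \<le> j" "j < m" for j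
  proof -
    have j': "j \<in> {1..m}" "Suc j \<in> {1..m}" using j by auto
    have "Lim (at_right (x j)) (periodic_ext a b (\<lambda>t. p t * of_real (r t))) = C (Suc j) (x j)"
      using sc[OF j'(2)] xj[OF j'(2)] unfolding segment_coeff_def
      by (intro Lim_right_periodic_ext[where v = "x (Suc j)" and N = "N (Suc j)"]) auto
    moreover have "Lim (at_left (x j)) (periodic_ext a b (\<lambda>t. p t * of_real (r t))) = C j (x j)"
      using sc[OF j'(1)] xj[OF j'(1)] unfolding segment_coeff_def
      by (intro Lim_left_periodic_ext[where u = "x (j - 1)" and N = "N j"]) auto
    ultimately show ?thesis using assms(10) j'(1) by metis
  qed
  obtain Q0 where Q0: "AE t in lebesgue_on {a..b}. norm (q t) \<le> Q0" using assms(9) unfolding Linfty_def by blast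
  define Q where "Q = max Q0 0"
  have Q: "Q \<ge> 0" "AE t in lebesgue_on {a..b}. norm (q t) \<le> Q"
    using Q0 by (auto simp: Q_def elim!: eventually_mono)
  define NN where "NN = Max (N ` {1..m})"
  have NN: "N j \<le> NN" "N j > 0" if "j \<in> {1..m}" for j
    using that sc[OF that] by (auto simp: NN_def segment_coeff_def)
  have NN0: "NN > 0" using NN[of 1] m by auto
  have pw: "AE t in lebesgue_on {a..b}. 1 / NN \<le> norm (p t) \<and> norm (w t) \<le> NN"
  proof -
    have "AE t in lebesgue_on {a..b}. t \<notin> x ` {..m}" by (rule AE_lebesgue_on_not_in_finite) auto
    moreover have "AE t in lebesgue_on {a..b}. t \<in> {a..b}" by (simp add: AE_restrict_space_iff)
    ultimately show ?thesis
    proof eventually_elim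
      case (elim t)
      then obtain j where j: "j \<in> {1..m}" "t \<in> {x (j - 1)<..<x j}"
        using partition_cover[OF part, of t] xa xb by auto
      then have "t \<in> {x (j - 1)..x j}" by auto
      then have "1 / N j \<le> norm (p t)" "norm (w t) \<le> N j"
        using sc[OF j(1)] j(2) unfolding segment_coeff_def by metis+
      moreover have "1 / NN \<le> 1 / N j" using NN[OF j(1)] by (intro divide_left_mono) auto
      ultimately show ?case using NN(1)[OF j(1)] by linarith
    qed
  qed
  have m1: "1 \<in> {1..m}" "m \<in> {1..m}" using m by auto
  obtain K0 where K0: "\<forall>\<kappa> y U. norm \<kappa> \<ge> K0 \<longrightarrow> 2 * Re \<kappa> \<ge> norm \<kappa> \<longrightarrow> sl_system (x 0) (x m) p w Q \<kappa> y U \<longrightarrow>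
      y (x 0) = 0 \<or> U (x 0) = 0 \<longrightarrow> in_cone (1 / 2) (C m (x m)) (y (x m)) (U (x m) / \<kappa>)"
    using iterated_cone_contraction[OF part m sc jump Q(1) m order_refl, of "1 / 2"] by auto
  \<comment> \<open>the maximum with \<open>1\<close> makes \<open>\<kappa>\<close> nonzero\<close>
  define K1 where "K1 = max K0 1"
  have bound: "norm \<mu> < K1\<^sup>2 + 1" if ev: "sl_eigenvalue bc a b p q w \<mu>" and Re: "Re \<mu> < 0"
    and bc: "bc \<in> {dirichlet_bc, neumann_bc}" for bc \<mu>
  proof (rule ccontr)
    assume "\<not> norm \<mu> < K1\<^sup>2 + 1"
    define \<kappa> where "\<kappa> = csqrt (- \<mu>)"
    have \<kappa>2: "\<kappa>\<^sup>2 = - \<mu>" by (simp add: \<kappa>_def)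
    have "K1\<^sup>2 \<le> (norm \<kappa>)\<^sup>2" using \<open>\<not> _\<close> by (simp add: norm_power[symmetric] \<kappa>2)
    then have "K1 \<le> norm \<kappa>" by (rule power2_le_imp_le) simp
    then have \<kappa>: "K0 \<le> norm \<kappa>" "\<kappa> \<noteq> 0" by (auto simp: K1_def)
    obtain y where sol: "sl_solution a b p q w \<mu> y" and y: "bc a b y" "\<exists>t\<in>{a..b}. y t \<noteq> 0"
      using ev unfolding sl_eigenvalue_def by blast
    obtain U where sys: "sl_system a b p w Q \<kappa> y U"
      using sl_solution_imp_system[OF sol NN0 Q(1) pw Q(2) \<kappa>2] by blast
    have ends: "(y a = 0 \<or> U a = 0) \<and> (y b = 0 \<or> U b = 0)"
    proof (cases "bc = dirichlet_bc")
      case True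
      then show ?thesis using y(1) by (simp add: dirichlet_bc_def)
    next
      case False
      then have N: "(y has_vector_derivative 0) (at a within {a..b})" "(y has_vector_derivative 0) (at b within {a..b})"
        using bc y(1) by (auto simp: neumann_bc_def)
      have "U a = 0"
      proof (rule neumann_imp_quasi_derivative_zero[OF xj(2)[OF m1(1)] sc[OF m1(1)] _ _ _ N(1)])
        show "sl_system (x (1 - 1)) (x 1) p w Q \<kappa> y U"
          using xj[OF m1(1)] by (intro sl_system_subinterval[OF sys]) auto
      qed (use xj[OF m1(1)] xa in auto)
      moreover have "U b = 0"
      proof (rule neumann_imp_quasi_derivative_zero[OF xj(2)[OF m1(2)] sc[OF m1(2)] _ _ _ N(2)])
        show "sl_system (x (m - 1)) (x m) p w Q \<kappa> y U"
          using xj[OF m1(2)] by (intro sl_system_subinterval[OF sys]) auto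
      qed (use xj[OF m1(2)] xb in auto)
      ultimately show ?thesis by simp
    qed
    have "in_cone (1 / 2) (C m b) (y b) (U b / \<kappa>)"
      using K0[rule_format, OF \<kappa>(1) _ _ , of y U] csqrt_left_half_plane[OF Re] sys ends
      by (simp add: xa xb flip: \<kappa>_def)
    moreover have "C m b \<noteq> 0"
      using xj[OF m1(2)] xb by (intro segment_coeff_nonzero[OF sc[OF m1(2)]]) auto
    ultimately have "y b = 0 \<and> U b / \<kappa> = 0" using ends by (intro in_cone_end) auto
    then have "y t = 0" if "t \<in> {a..b}" for t
      using sl_system_uniqueness[OF sys NN0 Q(1) pw _ _ that] \<kappa>(2) by simp
    then show False using y(2) by blast
  qed
  show ?thesis
  proof
    fix bc assume bc: "bc \<in> {dirichlet_bc, neumann_bc}"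
    have "K1\<^sup>2 + 1 > 0" by (smt (verit) zero_le_power2)
    then show "\<exists>R0>0. \<forall>\<mu>. sl_eigenvalue bc a b p q w \<mu> \<and> Re \<mu> < 0 \<longrightarrow> norm \<mu> < R0"
      using bound bc by blast
  qed
qed

end
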